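(* Let $f\in C(\mathbb{R},\mathbb{R})$ satisfy $(F1)$ and $(F2)$, let $\rho\in C(\mathbb{R}^3,\mathbb{R})$ satisfy $(D1)$, and suppose that $\rho_{\min}:=\inf_{x\in\mathbb{R}^3}\rho(x)>\sqrt{\overline{\Lambda}_0}$. Then $u=0$ is the unique solution of the equation $$-\Delta u+u+\rho(x)\phi_{\rho,u}u=f(u)\quad\text{in }\mathbb{R}^3,\qquad u\in H^1(\mathbb{R}^3).$$
   Context: Conditions: $(F1)$ $f$ is continuous, $f(s)=0$ for all $s<0$, and $\lim_{s\to0^+}f(s)/s=0$. $(F2)$ There exist $2\le q<3$ and $a_q$, with $a_q>1$ if $q=2$ and $a_q>0$ if $2<q<3$, such that $\lim_{s\to\infty}f(s)/s^{q-1}=a_q$. $(D1)$ $\rho(x)>0$ on $\mathbb{R}^3$ and $\lim_{|x|\to\infty}\rho(x)=\rho_\infty>0$. Notation: $F(u)=\int_0^uf(s)\,ds$; $\|u\|_{H^1}^2=\int_{\mathbb{R}^3}(|\nabla u|^2+u^2)\,dx$; $\phi_{\rho,u}(x)=\frac1{4\pi}\int_{\mathbb{R}^3}\frac{\rho(y)u^2(y)}{|x-y|}\,dy$ and $\phi_u=\phi_{1,u}$. Solutions are the critical points in $H^1(\mathbb{R}^3)$ of $J_\rho(u)=\frac12\|u\|_{H^1}^2+\frac14\int_{\mathbb{R}^3}\rho(x)\phi_{\rho,u}u^2\,dx-\int_{\mathbb{R}^3}F(u)\,dx$. $$\overline{\Lambda}_0=\sup_{u\in\overline{\mathbf{A}}_0}\frac{\int_{\mathbb{R}^3}f(u)u\,dx-\|u\|_{H^1}^2}{\int_{\mathbb{R}^3}\phi_uu^2\,dx},\qquad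 \overline{\mathbf{A}}_0=\Big\{u\in H^1(\mathbb{R}^3):\int_{\mathbb{R}^3}f(u)u\,dx-\|u\|_{H^1}^2>0\Big\};$$ $\overline{\Lambda}_0$ is positive and finite. *)

theory Defs
  imports "HOL-Analysis.Analysis"
begin

primrec Ck :: "nat \<Rightarrow> (real^3 \<Rightarrow> real) \<Rightarrow> bool" where
  "Ck 0 \<psi> \<longleftrightarrow> continuous_on UNIV \<psi>"
| "Ck (Suc k) \<psi> \<longleftrightarrow> (\<forall>x. \<psi> differentiable (at x)) \<and>
     (\<forall>v. Ck k (\<lambda>x. frechet_derivative \<psi> (at x) v))"

definition test_function :: "(real^3 \<Rightarrow> real) \<Rightarrow> bool" where
  "test_function \<psi> \<longleftrightarrow> (\<forall>k. Ck k \<psi>) \<and> compact (closure {x. \<psi> x \<noteq> 0})"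

definition square_integrable :: "(real^3 \<Rightarrow> 'b::euclidean_space) \<Rightarrow> bool" where
  "square_integrable u \<longleftrightarrow>
     u \<in> borel_measurable lebesgue \<and> integrable lebesgue (\<lambda>x. (norm (u x))\<^sup>2)"

definition is_weak_gradient :: "(real^3 \<Rightarrow> real) \<Rightarrow> (real^3 \<Rightarrow> real^3) \<Rightarrow> bool" where
  "is_weak_gradient u g \<longleftrightarrow> square_integrable g \<and>
     (\<forall>\<psi>. test_function \<psi> \<longrightarrow> (\<forall>i.
        (\<integral>x. u x * frechet_derivative \<psi> (at x) (axis i 1) \<partial>lebesgue)
          = - (\<integral>x. (g x $ i) * \<psi> x \<partial>lebesgue)))"

text \<open>The elements of $H^1(\mathbb{R}^3)$ are represented by functions; two functions that agree
  almost everywhere stand for the same element.\<close>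

definition H1 :: "(real^3 \<Rightarrow> real) set" where
  "H1 = {u. square_integrable u \<and> (\<exists>g. is_weak_gradient u g)}"

text \<open>For \<open>u \<in> H1\<close> the weak gradient is unique up to a null set, so the choice
  below does not affect any integral.\<close>

definition weak_gradient :: "(real^3 \<Rightarrow> real) \<Rightarrow> real^3 \<Rightarrow> real^3" where
  "weak_gradient u = (SOME g. is_weak_gradient u g)"

definition H1_norm :: "(real^3 \<Rightarrow> real) \<Rightarrow> real" where
  "H1_norm u = sqrt (\<integral>x. (norm (weak_gradient u x))\<^sup>2 + (u x)\<^sup>2 \<partial>lebesgue)"

definition primitive :: "(real \<Rightarrow> real) \<Rightarrow> real \<Rightarrow> real" where
  "primitive f t = (LBINT s=0..ereal t. f s)"

definition phi :: "(real^3 \<Rightarrow> real) \<Rightarrow> (real^3 \<Rightarrow> real) \<Rightarrow> real^3 \<Rightarrow> real" where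
  "phi \<rho> u x = 1 / (4 * pi) * (\<integral>y. \<rho> y * (u y)\<^sup>2 / norm (x - y) \<partial>lebesgue)"

definition J :: "(real \<Rightarrow> real) \<Rightarrow> (real^3 \<Rightarrow> real) \<Rightarrow> (real^3 \<Rightarrow> real) \<Rightarrow> real" where
  "J f \<rho> u = 1/2 * (H1_norm u)\<^sup>2
     + 1/4 * (\<integral>x. \<rho> x * phi \<rho> u x * (u x)\<^sup>2 \<partial>lebesgue)
     - (\<integral>x. primitive f (u x) \<partial>lebesgue)"

text \<open>\<open>has_H1_derivative E L u\<close>: the functional \<open>E\<close> on the normed space \<open>H1\<close> is Frechet
  differentiable at \<open>u\<close> with derivative the bounded linear functional \<open>L\<close>.\<close>

definition has_H1_derivative ::
  "((real^3 \<Rightarrow> real) \<Rightarrow> real) \<Rightarrow> ((real^3 \<Rightarrow> real) \<Rightarrow> real) \<Rightarrow> (real^3 \<Rightarrow> real) \<Rightarrow> bool" where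
  "has_H1_derivative E L u \<longleftrightarrow>
     (\<forall>v\<in>H1. \<forall>w\<in>H1. \<forall>a b. L (\<lambda>x. a * v x + b * w x) = a * L v + b * L w) \<and>
     (\<exists>C. \<forall>v\<in>H1. \<bar>L v\<bar> \<le> C * H1_norm v) \<and>
     (\<forall>\<epsilon>>0. \<exists>\<delta>>0. \<forall>h\<in>H1. H1_norm h < \<delta> \<longrightarrow>
        \<bar>E (\<lambda>x. u x + h x) - E u - L h\<bar> \<le> \<epsilon> * H1_norm h)"

definition critical_point :: "((real^3 \<Rightarrow> real) \<Rightarrow> real) \<Rightarrow> (real^3 \<Rightarrow> real) \<Rightarrow> bool" where
  "critical_point E u \<longleftrightarrow> u \<in> H1 \<and> has_H1_derivative E (\<lambda>_. 0) u"

definition solution :: "(real \<Rightarrow> real) \<Rightarrow> (real^3 \<Rightarrow> real) \<Rightarrow> (real^3 \<Rightarrow> real) \<Rightarrow> bool" where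
  "solution f \<rho> u \<longleftrightarrow> critical_point (J f \<rho>) u"

definition F1 :: "(real \<Rightarrow> real) \<Rightarrow> bool" where
  "F1 f \<longleftrightarrow> continuous_on UNIV f \<and> (\<forall>s<0. f s = 0) \<and> ((\<lambda>s. f s / s) \<longlongrightarrow> 0) (at_right 0)"

definition F2 :: "(real \<Rightarrow> real) \<Rightarrow> bool" where
  "F2 f \<longleftrightarrow> (\<exists>q a. 2 \<le> q \<and> q < 3 \<and> (q = 2 \<longrightarrow> a > 1) \<and> (2 < q \<longrightarrow> a > 0) \<and>
     ((\<lambda>s. f s / s powr (q - 1)) \<longlongrightarrow> a) at_top)"

definition D1 :: "(real^3 \<Rightarrow> real) \<Rightarrow> bool" where
  "D1 \<rho> \<longleftrightarrow> (\<forall>x. \<rho> x > 0) \<and> (\<exists>\<rho>_inf>0. (\<rho> \<longlongrightarrow> \<rho>_inf) at_infinity)"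

definition A0_bar :: "(real \<Rightarrow> real) \<Rightarrow> (real^3 \<Rightarrow> real) set" where
  "A0_bar f = {u \<in> H1. (\<integral>x. f (u x) * u x \<partial>lebesgue) - (H1_norm u)\<^sup>2 > 0}"

text \<open>The supremum is taken in the extended reals, so that it is meaningful without a
  separate boundedness argument (for \<open>f\<close> satisfying \<open>F1\<close> and \<open>F2\<close> it is positive and finite).\<close>

definition Lambda0_bar :: "(real \<Rightarrow> real) \<Rightarrow> ereal" where
  "Lambda0_bar f = (SUP u \<in> A0_bar f.
     ereal (((\<integral>x. f (u x) * u x \<partial>lebesgue) - (H1_norm u)\<^sup>2)
       / (\<integral>x. phi (\<lambda>_. 1) u x * (u x)\<^sup>2 \<partial>lebesgue)))"

definition ereal_sqrt :: "ereal \<Rightarrow> ereal" where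
  "ereal_sqrt x = (if \<bar>x\<bar> = \<infinity> then x else ereal (sqrt (real_of_ereal x)))"

end

theory Submission
  imports Defs
begin

text \<open>Testing the equation with the solution \<open>u\<close> itself, i.e. differentiating \<open>J\<close> along the ray
  through \<open>u\<close>, gives \<open>\<integral>f(u)u - \<parallel>u\<parallel>\<^sup>2 = \<integral>\<rho>\<phi>\<^bsub>\<rho>,u\<^esub>u\<^sup>2\<close>. If the Coulomb energy on the right is positive,
  then \<open>u\<close> competes in the supremum \<open>\<Lambda>\<close>, so the energy is at most \<open>\<Lambda>\<integral>\<phi>\<^sub>uu\<^sup>2 < \<rho>\<^sub>m\<^sub>i\<^sub>n\<^sup>2\<integral>\<phi>\<^sub>uu\<^sup>2\<close>, which
  in turn is at most the energy itself. Hence the energy vanishes and \<open>u = 0\<close>.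

  The integrals involved are finite because \<open>u\<close> is cubically integrable and its Coulomb potential is bounded.
  Both follow from the translation estimate \<open>\<parallel>u(\<cdot> + y) - u\<parallel> \<le> \<bar>y\<bar> \<parallel>\<nabla>u\<parallel>\<close> in \<open>L\<^sup>2\<close>, which is obtained
  from the weak formulation by duality with test functions, without any mollification.\<close>

subsection \<open>Smooth compactly supported functions\<close>

text \<open>Because q < 3, the nonlinearity grows at most like |s| + s^2, so cubic integrability of
  u controls every nonlinear term. A gradient in L^2 gives more than that in dimension three, and
  this slack replaces the sharp Sobolev and Hardy-Littlewood-Sobolev inequalities: at each scale r,
  u is compared with its mean squares over balls of radius r, the translation estimate makes the
  oscillation of order r^2, and the scales are geometric sequences tuned so that all errors form
  series of ratio 1/2. The constants 65 and 257 come from these series. The obstacle is that H1 is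
  described by weak gradients alone. Everything about its elements has to be extracted from
  integrals against test functions, and so L^2 norms are estimated by duality, which rests on an
  explicit supply of test functions: polynomials times bump functions. The bounds are quantitative
  because 0 is critical only if J(h) = o(norm of h), so integrability alone would not do. For a
  general solution no derivative formula for J is required: its derivative there is 0 by assumption,
  and only the limit along one ray is computed.\<close>

definition flat :: "real poly \<Rightarrow> real \<Rightarrow> real" where
  "flat p x = (if x > 0 then poly p (1 / x) * exp (- (1 / x)) else 0)"

lemma tendsto_poly_mult_exp_minus: "((\<lambda>x. poly p x * exp (- x)) \<longlongrightarrow> (0::real)) at_top"
proof -
  have "((\<lambda>x. \<Sum>i\<le>degree p. coeff p i * (x ^ i / exp x)) \<longlongrightarrow> (\<Sum>i\<le>degree p. coeff p i * 0)) at_top"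
    by (intro tendsto_intros tendsto_power_div_exp_0)
  moreover have "(\<Sum>i\<le>degree p. coeff p i * (x ^ i / exp x)) = poly p x * exp (- x)" for x
    by (simp add: poly_altdef sum_distrib_right exp_minus divide_inverse mult.assoc)
  ultimately show ?thesis by simp
qed

lemma tendsto_flat_0: "(flat p \<longlongrightarrow> 0) (at 0)"
proof -
  have "((\<lambda>x. poly p (inverse x) * exp (- inverse x)) \<longlongrightarrow> 0) (at_right 0)"
    using tendsto_poly_mult_exp_minus filterlim_inverse_at_top_right
    by (rule filterlim_compose[where f = inverse])
  then have "(flat p \<longlongrightarrow> 0) (at_right 0)"
    by (rule Lim_transform_eventually)
       (auto simp: flat_def eventually_at_right_less inverse_eq_divide intro: eventually_at_rightI[of 0 1])
  moreover have "(flat p \<longlongrightarrow> 0) (at_left 0)"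
    by (rule Lim_transform_eventually[OF tendsto_const])
       (auto simp: flat_def intro: eventually_at_leftI[of "-1"])
  ultimately show ?thesis
    by (simp add: filterlim_split_at)
qed

text \<open>With y = 1/x, differentiating p(y) exp(-y) in x gives y^2 (p - p')(y) exp(-y), so the
  class of these functions is closed under differentiation. At the origin the difference quotient is
  again of this class, for the polynomial y p(y), and hence tends to 0.\<close>

lemma has_real_derivative_flat:
  "(flat p has_real_derivative flat (monom 1 2 * (p - pderiv p)) x) (at x)"
proof -
  consider "x > 0" | "x < 0" | "x = 0" by linarith
  then show ?thesis
  proof cases
    case 1
    have "((\<lambda>x. poly p (1 / x) * exp (- (1 / x))) has_real_derivative
        flat (monom 1 2 * (p - pderiv p)) x) (at x)"
      using 1 by (auto intro!: derivative_eq_intros simp: flat_def poly_monom field_simps power2_eq_square)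
    then show ?thesis
      by (rule has_field_derivative_transform_within[of _ _ _ _ x]) (use 1 in \<open>auto simp: flat_def dist_real_def\<close>)
  next
    case 2
    have "((\<lambda>x. 0) has_real_derivative flat (monom 1 2 * (p - pderiv p)) x) (at x)"
      using 2 by (simp add: flat_def)
    then show ?thesis
      by (rule has_field_derivative_transform_within[of _ _ _ _ "- x"]) (use 2 in \<open>auto simp: flat_def dist_real_def\<close>)
  next
    case 3
    have "flat p h / h = flat (monom 1 1 * p) h" for h
      by (simp add: flat_def poly_monom)
    then have "((\<lambda>h. flat p h / h) \<longlongrightarrow> 0) (at 0)"
      using tendsto_flat_0[of "monom 1 1 * p"] by simp
    then show ?thesis using 3 by (simp add: has_field_derivative_iff flat_def)
  qed
qed

section \<open>Closure properties of k times continuously differentiable functions\<close>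

lemma Ck_continuous: "Ck k \<psi> \<Longrightarrow> continuous_on UNIV \<psi>"
  by (cases k) (auto simp: continuous_on_eq_continuous_at intro: differentiable_imp_continuous_within)

lemma Ck_SucD: "Ck (Suc k) \<psi> \<Longrightarrow> Ck k \<psi>"
proof (induction k arbitrary: \<psi>)
  case 0
  then show ?case using Ck_continuous by (metis Ck.simps(1))
next
  case (Suc k)
  then show ?case by auto
qed

lemma Ck_SucI:
  assumes "\<And>x. (\<psi> has_derivative D x) (at x)" "\<And>v. Ck k (\<lambda>x. D x v)"
  shows "Ck (Suc k) \<psi>"
proof -
  have "frechet_derivative \<psi> (at x) = D x" for x
    using assms(1) frechet_derivative_at by metis
  then show ?thesis using assms by (auto simp: differentiable_def)
qed

lemma Ck_const: "Ck k (\<lambda>x. c)"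
proof (induction k arbitrary: c)
  case (Suc k)
  show ?case by (rule Ck_SucI[OF has_derivative_const]) (rule Suc)
qed simp

lemma Ck_has_derivative:
  "Ck (Suc k) \<psi> \<Longrightarrow> (\<psi> has_derivative frechet_derivative \<psi> (at x)) (at x)"
  using frechet_derivative_works by auto

lemma Ck_add: "Ck k a \<Longrightarrow> Ck k b \<Longrightarrow> Ck k (\<lambda>x. a x + b x)"
proof (induction k arbitrary: a b)
  case (Suc k)
  show ?case
    by (rule Ck_SucI, rule has_derivative_add[OF Ck_has_derivative Ck_has_derivative], fact+)
       (use Suc in \<open>auto simp: intro!: Suc.IH\<close>)
qed (auto intro: continuous_intros)

lemma Ck_mult: "Ck k a \<Longrightarrow> Ck k b \<Longrightarrow> Ck k (\<lambda>x. a x * b x)"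
proof (induction k arbitrary: a b)
  case (Suc k)
  have "Ck k a" "Ck k b" using Suc.prems Ck_SucD by auto
  show ?case
    by (rule Ck_SucI, rule has_derivative_mult[OF Ck_has_derivative Ck_has_derivative], fact+)
       (use Suc \<open>Ck k a\<close> \<open>Ck k b\<close> in \<open>auto intro!: Ck_add Suc.IH\<close>)
qed (auto intro: continuous_intros)

lemma Ck_linear: "bounded_linear l \<Longrightarrow> Ck k l"
  by (cases k) (auto intro!: Ck_SucI Ck_const bounded_linear_imp_has_derivative
      simp: linear_continuous_on simp del: Ck.simps(2))

lemma Ck_polynomial: "real_polynomial_function p \<Longrightarrow> Ck k p"
  by (induction rule: real_polynomial_function.induct) (auto intro: Ck_linear Ck_const Ck_add Ck_mult)

text \<open>Each derivative is a function of the same shape times a linear form in x; the polynomial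
  changes, so the induction is over all p at once. Using the polynomial x \<bullet> x instead of the
  norm avoids the singularity of the norm at 0.\<close>

lemma Ck_flat: "Ck k (\<lambda>x. flat p (c - x \<bullet> x))"
proof (induction k arbitrary: p)
  case 0
  have "continuous_on UNIV (flat p)"
    by (meson DERIV_continuous_on has_field_derivative_at_within has_real_derivative_flat)
  then show ?case
    by (auto intro!: continuous_on_compose2[of UNIV "flat p"] continuous_intros)
next
  case (Suc k)
  let ?q = "monom 1 2 * (p - pderiv p)"
  have "((\<lambda>x. flat p (c - x \<bullet> x)) has_derivative
      (\<lambda>v. flat ?q (c - x \<bullet> x) * (- 2 * (x \<bullet> v)))) (at x)" for x :: "real^3"
  proof -
    have "((\<lambda>x. c - x \<bullet> x) has_derivative (\<lambda>v. - 2 * (x \<bullet> v))) (at x)"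
      by (auto intro!: derivative_eq_intros simp: inner_commute)
    from has_derivative_compose[OF this has_real_derivative_flat[unfolded has_field_derivative_def]]
    show ?thesis by simp
  qed
  then show ?case
    by (rule Ck_SucI) (intro Ck_mult Ck_const Ck_linear bounded_linear_inner_left Suc)
qed

text \<open>The standard bump exp(-1/(R^2 - |x|^2)). It is strictly positive in the whole open ball,
  so that one can divide by it on smaller balls.\<close>

definition cutoff :: "real \<Rightarrow> real^3 \<Rightarrow> real" where
  "cutoff R x = flat 1 (R\<^sup>2 - x \<bullet> x)"

lemma cutoff_eq_0: "R \<le> norm x \<Longrightarrow> 0 \<le> R \<Longrightarrow> cutoff R x = 0"
  by (simp add: cutoff_def flat_def dot_square_norm not_less power_mono)

lemma cutoff_nonneg: "0 \<le> cutoff R x" and cutoff_le_1: "cutoff R x \<le> 1"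
  by (auto simp: cutoff_def flat_def)

lemma cutoff_pos: "norm x < R \<Longrightarrow> 0 < cutoff R x"
  by (simp add: cutoff_def flat_def dot_square_norm power_strict_mono)

lemma continuous_cutoff: "continuous_on A (cutoff R)"
  using Ck_flat[of 0 1 "R\<^sup>2"] unfolding cutoff_def[abs_def] by (auto intro: continuous_on_subset)

text \<open>Polynomials are the smooth factors here because Stone-Weierstrass makes them dense among
  continuous functions on the ball.\<close>

lemma test_function_polynomial_cutoff:
  assumes "real_polynomial_function p" "0 \<le> R"
  shows "test_function (\<lambda>x. p x * cutoff R x)"
proof -
  have "{x. p x * cutoff R x \<noteq> 0} \<subseteq> cball 0 R"
    using cutoff_eq_0[of R] assms(2) by (auto simp: dist_norm) (meson linear)
  then have "compact (closure {x. p x * cutoff R x \<noteq> 0})"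
    by (meson bounded_cball bounded_closure bounded_subset closed_closure compact_eq_bounded_closed)
  then show ?thesis
    unfolding test_function_def cutoff_def by (intro conjI allI Ck_mult Ck_flat Ck_polynomial assms)
qed

subsection \<open>Duality of square integrable functions with test functions\<close>

lemma integrable_mult_bounded_support:
  fixes w \<phi> :: "real^3 \<Rightarrow> real"
  assumes [measurable]: "w \<in> borel_measurable borel" "\<phi> \<in> borel_measurable borel"
    and "integrable lborel (\<lambda>x. (w x)\<^sup>2)"
    and bd: "\<And>x. \<bar>\<phi> x\<bar> \<le> B * indicator (cball 0 R) x"
  shows "integrable lborel (\<lambda>x. w x * \<phi> x)"
proof (rule Bochner_Integration.integrable_bound)
  have "integrable lborel (\<lambda>x::real^3. indicator (cball 0 R) x :: real)"
    by (intro integrable_real_indicator) (use emeasure_bounded_finite[of "cball (0::real^3) R"] in auto)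
  then show "integrable lborel (\<lambda>x. \<bar>B\<bar> * ((w x)\<^sup>2 + indicator (cball 0 R) x))"
    using assms(3) by (intro integrable_mult_right Bochner_Integration.integrable_add)
  show "AE x in lborel. norm (w x * \<phi> x) \<le> norm (\<bar>B\<bar> * ((w x)\<^sup>2 + indicator (cball 0 R) x))"
  proof (rule AE_I2)
    fix x
    have 1: "\<bar>w x\<bar> \<le> (w x)\<^sup>2 + 1"
      using zero_le_power2[of "\<bar>w x\<bar> - 1 / 2"] by (simp add: power2_diff power_divide)
    have "\<bar>w x\<bar> * \<bar>\<phi> x\<bar> \<le> \<bar>w x\<bar> * (\<bar>B\<bar> * indicator (cball 0 R) x)"
      by (rule mult_left_mono, rule order.trans[OF bd]) (auto intro: mult_right_mono)
    also have "\<dots> \<le> \<bar>B\<bar> * ((w x)\<^sup>2 + indicator (cball 0 R) x)"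
      using mult_left_mono[OF 1, of "\<bar>B\<bar>"] by (auto simp: indicator_def mult.commute)
    finally show "norm (w x * \<phi> x) \<le> norm (\<bar>B\<bar> * ((w x)\<^sup>2 + indicator (cball 0 R) x))"
      by (simp add: abs_mult)
  qed
qed measurable

text \<open>Dominated convergence applies on both sides: |w| is integrable over the ball that
  carries all the \<open>\<Phi> n\<close>, and these are uniformly bounded.\<close>

lemma L2_duality_closed:
  fixes w \<phi> :: "real^3 \<Rightarrow> real"
  assumes [measurable]: "w \<in> borel_measurable borel" "\<phi> \<in> borel_measurable borel"
      "\<And>n. \<Phi> n \<in> borel_measurable borel"
    and int: "integrable lborel (\<lambda>x. (w x)\<^sup>2)"
    and le: "\<And>n. (\<integral>x. w x * \<Phi> n x \<partial>lborel) \<le> M * sqrt (\<integral>x. (\<Phi> n x)\<^sup>2 \<partial>lborel)"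
    and bd: "\<And>n x. \<bar>\<Phi> n x\<bar> \<le> B * indicator (cball 0 R) x"
    and lim: "AE x in lborel. (\<lambda>n. \<Phi> n x) \<longlonglongrightarrow> \<phi> x"
  shows "(\<integral>x. w x * \<phi> x \<partial>lborel) \<le> M * sqrt (\<integral>x. (\<phi> x)\<^sup>2 \<partial>lborel)"
proof -
  have bd': "\<bar>\<Phi> n x\<bar> \<le> \<bar>B\<bar> * indicator (cball 0 R) x" for n x
    by (rule order.trans[OF bd]) (auto intro: mult_right_mono)
  have "integrable lborel (\<lambda>x. \<bar>w x\<bar> * (\<bar>B\<bar> * indicator (cball 0 R) x))"
    by (rule integrable_mult_bounded_support[where B = "\<bar>B\<bar>" and R = R]) 
       (use int in \<open>auto simp: abs_mult intro!: borel_measurable_times borel_measurable_indicator\<close>)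
  then have 1: "(\<lambda>n. \<integral>x. w x * \<Phi> n x \<partial>lborel) \<longlonglongrightarrow> (\<integral>x. w x * \<phi> x \<partial>lborel)"
    by (rule integral_dominated_convergence[rotated 2])
       (use lim bd' in \<open>auto intro!: tendsto_intros mult_left_mono simp: abs_mult elim!: eventually_mono\<close>)
  have "integrable lborel (\<lambda>x::real^3. B\<^sup>2 * indicator (cball 0 R) x :: real)"
    by (intro integrable_mult_right integrable_real_indicator) (use emeasure_bounded_finite[of "cball (0::real^3) R"] in auto)
  moreover have "norm ((\<Phi> n x)\<^sup>2) \<le> B\<^sup>2 * indicator (cball 0 R) x" for n x
    using power_mono[OF bd'[of n x], of 2] by (auto simp: indicator_def)
  ultimately have 2: "(\<lambda>n. \<integral>x. (\<Phi> n x)\<^sup>2 \<partial>lborel) \<longlonglongrightarrow> (\<integral>x. (\<phi> x)\<^sup>2 \<partial>lborel)"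
    by (intro integral_dominated_convergence[where w = "\<lambda>x. B\<^sup>2 * indicator (cball 0 R) x"])
       (use lim in \<open>auto intro!: tendsto_intros elim!: eventually_mono\<close>)
  show ?thesis
    by (rule LIMSEQ_le[OF 1 tendsto_mult[OF tendsto_const tendsto_real_sqrt[OF 2]]]) (use le in auto)
qed

text \<open>The inequality is extended from polynomials to continuous functions (times a bump) by
  uniform approximation, then to bounded measurable functions with bounded support by almost
  everywhere approximation. Among the latter are the truncations v of w itself; as w v = v^2,
  testing with v gives norm v <= M, and the truncation is removed at the end.\<close>

lemma L2_bound_by_test_functions:
  fixes w :: "real^3 \<Rightarrow> real"
  assumes [measurable]: "w \<in> borel_measurable borel"
    and int: "integrable lborel (\<lambda>x. (w x)\<^sup>2)"
    and "0 \<le> M"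
    and le: "\<And>\<psi>. test_function \<psi> \<Longrightarrow> (\<integral>x. w x * \<psi> x \<partial>lborel) \<le> M * sqrt (\<integral>x. (\<psi> x)\<^sup>2 \<partial>lborel)"
  shows "(\<integral>x. (w x)\<^sup>2 \<partial>lborel) \<le> M\<^sup>2"
proof -
  have [measurable]: "cutoff R \<in> borel_measurable borel" for R
    using continuous_cutoff borel_measurable_continuous_onI by blast
  have cont: "(\<integral>x. w x * (\<psi> x * cutoff R x) \<partial>lborel) \<le> M * sqrt (\<integral>x. (\<psi> x * cutoff R x)\<^sup>2 \<partial>lborel)"
    if "continuous_on UNIV \<psi>" "0 \<le> R" for \<psi> R
  proof -
    have [measurable]: "\<psi> \<in> borel_measurable borel"
      using that(1) borel_measurable_continuous_onI by blast
    have cb: "continuous_on (cball 0 R) \<psi>"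
      using that continuous_on_subset by blast
    have "\<exists>p. real_polynomial_function p \<and> (\<forall>x\<in>cball 0 R. \<bar>\<psi> x - p x\<bar> < 1 / Suc n)" for n
      by (rule Stone_Weierstrass_real_polynomial_function[OF compact_cball cb, of "1 / Suc n"]) auto
    then obtain p where p: "\<And>n. real_polynomial_function (p n)"
      "\<And>n x. x \<in> cball 0 R \<Longrightarrow> \<bar>\<psi> x - p n x\<bar> < 1 / Suc n"
      by metis
    have [measurable]: "p n \<in> borel_measurable borel" for n
      using Ck_continuous[OF Ck_polynomial[OF p(1)]] borel_measurable_continuous_onI by blast
    obtain B where B: "\<And>x. x \<in> cball 0 R \<Longrightarrow> \<bar>\<psi> x\<bar> \<le> B"
      using compact_imp_bounded[OF compact_continuous_image[OF cb compact_cball]]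
      unfolding bounded_iff by (metis imageI real_norm_def)
    show ?thesis
    proof (rule L2_duality_closed[where \<Phi> = "\<lambda>n x. p n x * cutoff R x" and B = "B + 1" and R = R])
      show "\<bar>p n x * cutoff R x\<bar> \<le> (B + 1) * indicator (cball 0 R) x" for n x
      proof (cases "x \<in> cball 0 R")
        case True
        have "1 / Suc n \<le> (1::real)" by simp
        then have "\<bar>p n x\<bar> \<le> B + 1" using p(2)[OF True, of n] B[OF True] by linarith
        then have "\<bar>p n x * cutoff R x\<bar> \<le> (B + 1) * 1"
          unfolding abs_mult using cutoff_nonneg[of R x] cutoff_le_1[of R x] by (intro mult_mono) auto
        then show ?thesis using True by simp
      qed (use cutoff_eq_0[of R x] that in auto)
      show "AE x in lborel. (\<lambda>n. p n x * cutoff R x) \<longlonglongrightarrow> \<psi> x * cutoff R x"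
      proof (rule AE_I2)
        fix x
        show "(\<lambda>n. p n x * cutoff R x) \<longlonglongrightarrow> \<psi> x * cutoff R x"
        proof (cases "x \<in> cball 0 R")
          case True
          have "(\<lambda>n. p n x - \<psi> x) \<longlonglongrightarrow> 0"
            by (rule Lim_null_comparison[OF _ lim_inverse_n'[THEN LIMSEQ_Suc]])
               (use p(2)[OF True] in \<open>auto intro!: always_eventually less_imp_le simp: abs_minus_commute\<close>)
          then have "(\<lambda>n. p n x) \<longlonglongrightarrow> \<psi> x" by (rule LIM_zero_cancel)
          then show ?thesis by (intro tendsto_intros)
        qed (use cutoff_eq_0[of R x] that in auto)
      qed
      show "(\<integral>x. w x * (p n x * cutoff R x) \<partial>lborel) \<le> M * sqrt (\<integral>x. (p n x * cutoff R x)\<^sup>2 \<partial>lborel)" for n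
        by (intro le test_function_polynomial_cutoff p that)
    qed (use int in auto)
  qed
  define v where "v n x = w x * indicator ({x. \<bar>w x\<bar> \<le> real n} \<inter> cball 0 (real n)) x" for n x
  have [measurable]: "v n \<in> borel_measurable borel" for n
    unfolding v_def[abs_def]
    by (intro borel_measurable_times borel_measurable_indicator sets.Int) auto
  have v: "(\<integral>x. (v n x)\<^sup>2 \<partial>lborel) \<le> M\<^sup>2" for n
  proof -
    \<comment> \<open>The bump radius exceeds n, so the bump has a positive minimum on the closed
      ball of radius n that contains the support of \<open>v n\<close>. Hence the quotient
      \<open>t\<close> of \<open>v n\<close> by the bump is bounded by \<open>K\<close>.\<close>
    let ?R = "real n + 1"
    have "continuous_on (cball 0 (real n)) (cutoff ?R)"
      by (rule continuous_cutoff)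
    then obtain y where y: "y \<in> cball 0 (real n)" "\<And>x. x \<in> cball 0 (real n) \<Longrightarrow> cutoff ?R y \<le> cutoff ?R x"
      using continuous_attains_inf[OF compact_cball, of 0 "real n" "cutoff ?R"]
      by (metis cball_eq_empty not_less of_nat_0_le_iff)
    define K where "K = real n / cutoff ?R y"
    have y0: "0 < cutoff ?R y" using y(1) by (intro cutoff_pos) auto
    then have K: "0 \<le> K" unfolding K_def by simp
    define t where "t x = v n x / cutoff ?R x" for x
    have [measurable]: "t \<in> borel_measurable borel" unfolding t_def[abs_def] by measurable
    have tK: "\<bar>t x\<bar> \<le> K" for x
    proof (cases "\<bar>w x\<bar> \<le> real n \<and> x \<in> cball 0 (real n)")
      case True
      then show ?thesis
        using y(2)[of x] y0 unfolding t_def v_def K_def by (auto simp: abs_div intro!: frac_le)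
    qed (use K in \<open>auto simp: t_def v_def\<close>)
    have tv: "t x * cutoff ?R x = v n x" for x
      using cutoff_pos[of x ?R] by (cases "x \<in> cball 0 (real n)") (auto simp: t_def v_def)
    \<comment> \<open>The gauge-integral notion \<open>measurable_on\<close> yields continuous
      functions that converge to \<open>t\<close> off a negligible set.\<close>
    have "t \<in> borel_measurable lebesgue"
      by (rule measurable_completion) simp
    then have "t measurable_on UNIV"
      by (simp add: measurable_on_iff_borel_measurable lebesgue_on_UNIV_eq)
    then obtain N g where N: "negligible N" and g: "\<And>k. continuous_on UNIV (g k)"
      "\<And>x. x \<notin> N \<Longrightarrow> (\<lambda>k. g k x) \<longlonglongrightarrow> t x"
      by (auto simp: measurable_on_def)
    \<comment> \<open>Clamping to [-K, K] provides the uniform bound for domination and preserves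
      the limit, since |t| <= K.\<close>
    define h where "h k x = max (- K) (min K (g k x))" for k x
    have h: "continuous_on UNIV (h k)" for k
      unfolding h_def by (intro continuous_intros g)
    have [measurable]: "h k \<in> borel_measurable borel" for k
      using h borel_measurable_continuous_onI by blast
    have "(\<integral>x. w x * v n x \<partial>lborel) \<le> M * sqrt (\<integral>x. (v n x)\<^sup>2 \<partial>lborel)"
    proof (rule L2_duality_closed[where \<Phi> = "\<lambda>k x. h k x * cutoff ?R x" and B = K and R = ?R])
      show "\<bar>h k x * cutoff ?R x\<bar> \<le> K * indicator (cball 0 ?R) x" for k x
      proof (cases "x \<in> cball 0 ?R")
        case True
        have "\<bar>h k x\<bar> \<le> K" unfolding h_def using K by auto
        then have "\<bar>h k x * cutoff ?R x\<bar> \<le> K * 1"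
          unfolding abs_mult using K cutoff_nonneg[of ?R x] cutoff_le_1[of ?R x] by (intro mult_mono) auto
        then show ?thesis using True by simp
      qed (use cutoff_eq_0[of ?R x] in auto)
      have "(\<lambda>k. h k x * cutoff ?R x) \<longlonglongrightarrow> v n x" if "x \<notin> N" for x
      proof -
        have "(\<lambda>k. h k x * cutoff ?R x) \<longlonglongrightarrow> max (- K) (min K (t x)) * cutoff ?R x"
          unfolding h_def by (intro tendsto_intros g that)
        also have "max (- K) (min K (t x)) = t x" using tK[of x] by auto
        finally show ?thesis using tv by simp
      qed
      moreover have "AE x in lebesgue. x \<notin> N"
        using N by (simp add: AE_not_in negligible_iff_null_sets)
      then have "AE x in lborel. x \<notin> N" by (simp add: AE_completion_iff)
      ultimately show "AE x in lborel. (\<lambda>k. h k x * cutoff ?R x) \<longlonglongrightarrow> v n x"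
        by (auto elim!: eventually_mono)
    qed (use int cont[OF h] in auto)
    moreover have "w x * v n x = (v n x)\<^sup>2" for x
      by (auto simp: v_def indicator_def power2_eq_square)
    ultimately have "(\<integral>x. (v n x)\<^sup>2 \<partial>lborel) \<le> M * sqrt (\<integral>x. (v n x)\<^sup>2 \<partial>lborel)" (is "?I \<le> _") by simp
    moreover have "0 \<le> ?I" by simp
    ultimately have "sqrt ?I * sqrt ?I \<le> M * sqrt ?I" by simp
    then have "sqrt ?I \<le> M" if "?I \<noteq> 0"
      by (rule mult_right_le_imp_le) (use that in \<open>simp add: less_le\<close>)
    then have "sqrt ?I \<le> M" using \<open>0 \<le> M\<close> by (cases "?I = 0") auto
    then show ?thesis using power_mono[of "sqrt ?I" M 2] by simp
  qed
  have "(\<lambda>n. \<integral>x. (v n x)\<^sup>2 \<partial>lborel) \<longlonglongrightarrow> (\<integral>x. (w x)\<^sup>2 \<partial>lborel)"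
  proof (rule integral_dominated_convergence[OF _ _ int])
    show "AE x in lborel. (\<lambda>n. (v n x)\<^sup>2) \<longlonglongrightarrow> (w x)\<^sup>2"
    proof (rule AE_I2, rule tendsto_eventually)
      fix x
      show "\<forall>\<^sub>F n in sequentially. (v n x)\<^sup>2 = (w x)\<^sup>2"
        using eventually_ge_at_top[of "nat \<lceil>max \<bar>w x\<bar> (norm x)\<rceil>"]
        by eventually_elim (auto simp: v_def indicator_def nat_le_iff ceiling_le_iff)
    qed
  qed (auto simp: v_def indicator_def)
  then show ?thesis by (rule LIMSEQ_le_const2) (use v in auto)
qed

subsection \<open>Weak gradients\<close>

lemma test_function_iff: "test_function \<psi> \<longleftrightarrow> (\<forall>k. Ck k \<psi>) \<and> (\<exists>R. \<forall>x. R < norm x \<longrightarrow> \<psi> x = 0)"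
proof -
  have "bounded {x. \<psi> x \<noteq> 0} \<longleftrightarrow> (\<exists>R. \<forall>x. R < norm x \<longrightarrow> \<psi> x = 0)"
    unfolding bounded_iff by (metis (mono_tags, lifting) linorder_not_less mem_Collect_eq)
  then show ?thesis by (simp add: test_function_def)
qed

lemma test_function_continuous: "test_function \<psi> \<Longrightarrow> continuous_on A \<psi>"
  unfolding test_function_def using Ck_continuous continuous_on_subset by blast

lemma test_function_borel: "test_function \<psi> \<Longrightarrow> \<psi> \<in> borel_measurable borel"
  using test_function_continuous borel_measurable_continuous_onI by blast

lemma test_function_bound:
  assumes "test_function \<psi>"
  obtains B R where "0 \<le> B" "\<And>x. \<bar>\<psi> x\<bar> \<le> B * indicator (cball 0 R) x"
proof -
  from assms obtain R where R: "\<And>x. R < norm x \<Longrightarrow> \<psi> x = 0"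
    by (auto simp: test_function_iff)
  have "bounded (\<psi> ` cball 0 R)"
    by (intro compact_imp_bounded compact_continuous_image test_function_continuous assms compact_cball)
  then obtain B where B: "\<And>x. x \<in> cball 0 R \<Longrightarrow> \<bar>\<psi> x\<bar> \<le> B"
    unfolding bounded_iff by (metis imageI real_norm_def)
  show thesis
  proof (rule that[of "max 0 B" R])
    show "\<bar>\<psi> x\<bar> \<le> max 0 B * indicator (cball 0 R) x" for x
      using R[of x] B[of x] by (auto simp: indicator_def not_le)
  qed simp
qed

lemma test_function_has_derivative:
  "test_function \<psi> \<Longrightarrow> (\<psi> has_derivative frechet_derivative \<psi> (at x)) (at x)"
  unfolding test_function_def using Ck_has_derivative by blast

lemma test_function_frechet_derivative:
  assumes "test_function \<psi>"
  shows "test_function (\<lambda>x. frechet_derivative \<psi> (at x) v)"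
proof -
  from assms obtain R where R: "\<And>x. R < norm x \<Longrightarrow> \<psi> x = 0"
    by (auto simp: test_function_iff)
  have "frechet_derivative \<psi> (at x) v = 0" if "R < norm x" for x
  proof -
    have "open {x::real^3. R < norm x}" by (intro open_Collect_less continuous_intros)
    then have "(\<psi> has_derivative (\<lambda>_. 0)) (at x)"
      by (rule has_derivative_transform_within_open[OF has_derivative_const]) (use R that in auto)
    then show ?thesis using frechet_derivative_at by metis
  qed
  moreover have "Ck k (\<lambda>x. frechet_derivative \<psi> (at x) v)" for k
    using assms Ck.simps(2)[of k \<psi>] by (auto simp: test_function_def simp del: Ck.simps)
  ultimately show ?thesis by (auto simp: test_function_iff)
qed

lemma has_derivative_shift:
  fixes \<psi> :: "'a::real_normed_vector \<Rightarrow> real"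
  assumes "\<And>x. (\<psi> has_derivative D x) (at x)"
  shows "((\<lambda>x. \<psi> (x - c)) has_derivative D (x - c)) (at x)"
proof -
  have "((\<lambda>x. x - c) has_derivative (\<lambda>v. v)) (at x)" by (auto intro!: derivative_eq_intros)
  from has_derivative_compose[OF this assms] show ?thesis by simp
qed

lemma Ck_shift: "Ck k \<psi> \<Longrightarrow> Ck k (\<lambda>x. \<psi> (x - c))"
proof (induction k arbitrary: \<psi>)
  case 0
  then show ?case by (auto intro!: continuous_on_compose2[of UNIV \<psi>] continuous_intros)
next
  case (Suc k)
  show ?case
    by (rule Ck_SucI, rule has_derivative_shift, rule Ck_has_derivative, fact)
       (use Suc in auto)
qed

lemma test_function_shift:
  assumes "test_function \<psi>"
  shows "test_function (\<lambda>x. \<psi> (x - c))"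
proof -
  from assms obtain R where R: "\<And>x. R < norm x \<Longrightarrow> \<psi> x = 0"
    by (auto simp: test_function_iff)
  have "\<psi> (x - c) = 0" if "R + norm c < norm x" for x
    using norm_triangle_ineq2[of x c] that by (intro R) simp
  with assms show ?thesis by (auto simp: test_function_iff intro: Ck_shift)
qed

section \<open>Translation invariance and the Cauchy-Schwarz inequality\<close>

lemma lborel_integral_translate:
  fixes h :: "'a::euclidean_space \<Rightarrow> real"
  assumes [measurable]: "h \<in> borel_measurable borel"
  shows "(\<integral>x. h (x + c) \<partial>lborel) = (\<integral>x. h x \<partial>lborel)"
    and "integrable lborel (\<lambda>x. h (x + c)) \<longleftrightarrow> integrable lborel h"
    and "(\<integral>\<^sup>+x. ennreal (h (x + c)) \<partial>lborel) = (\<integral>\<^sup>+x. ennreal (h x) \<partial>lborel)"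
proof -
  have d: "lborel = distr lborel borel (\<lambda>x. x + c)"
  proof -
    have "(\<lambda>x. x + c) = (+) c" by (simp add: fun_eq_iff add.commute)
    then show ?thesis by (simp only: lborel_distr_plus)
  qed
  show "(\<integral>x. h (x + c) \<partial>lborel) = (\<integral>x. h x \<partial>lborel)"
    by (subst (2) d, subst integral_distr) auto
  show "integrable lborel (\<lambda>x. h (x + c)) \<longleftrightarrow> integrable lborel h"
    by (subst (2) d, subst integrable_distr_eq) auto
  show "(\<integral>\<^sup>+x. ennreal (h (x + c)) \<partial>lborel) = (\<integral>\<^sup>+x. ennreal (h x) \<partial>lborel)"
    by (subst (2) d, subst nn_integral_distr) auto
qed

lemma integrable_mult_L2:
  fixes f g :: "'a \<Rightarrow> real"
  assumes [measurable]: "f \<in> borel_measurable M" "g \<in> borel_measurable M"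
    and "integrable M (\<lambda>x. (f x)\<^sup>2)" "integrable M (\<lambda>x. (g x)\<^sup>2)"
  shows "integrable M (\<lambda>x. f x * g x)"
proof (rule Bochner_Integration.integrable_bound)
  show "integrable M (\<lambda>x. (f x)\<^sup>2 + (g x)\<^sup>2)" using assms by auto
  have "\<bar>a * b\<bar> \<le> a\<^sup>2 + b\<^sup>2" for a b :: real
  proof -
    have "2 * \<bar>a * b\<bar> \<le> a\<^sup>2 + b\<^sup>2"
      using zero_le_power2[of "\<bar>a\<bar> - \<bar>b\<bar>"] by (simp add: power2_diff abs_mult)
    then show ?thesis using abs_ge_zero[of "a * b"] by linarith
  qed
  then show "AE x in M. norm (f x * g x) \<le> norm ((f x)\<^sup>2 + (g x)\<^sup>2)" by auto
qed measurable

lemma integral_Cauchy_Schwarz: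
  fixes f g :: "'a \<Rightarrow> real"
  assumes [measurable]: "f \<in> borel_measurable M" "g \<in> borel_measurable M"
    and f: "integrable M (\<lambda>x. (f x)\<^sup>2)" and g: "integrable M (\<lambda>x. (g x)\<^sup>2)"
  shows "\<bar>\<integral>x. f x * g x \<partial>M\<bar> \<le> sqrt (\<integral>x. (f x)\<^sup>2 \<partial>M) * sqrt (\<integral>x. (g x)\<^sup>2 \<partial>M)"
proof -
  let ?P = "\<integral>x. \<bar>f x * g x\<bar> \<partial>M"
  have "(\<integral>\<^sup>+x. ennreal \<bar>f x\<bar> * ennreal \<bar>g x\<bar> \<partial>M)\<^sup>2 \<le>
      (\<integral>\<^sup>+x. (ennreal \<bar>f x\<bar>)\<^sup>2 \<partial>M) * (\<integral>\<^sup>+x. (ennreal \<bar>g x\<bar>)\<^sup>2 \<partial>M)"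
    by (rule Cauchy_Schwarz_nn_integral) measurable
  also have "(\<integral>\<^sup>+x. ennreal \<bar>f x\<bar> * ennreal \<bar>g x\<bar> \<partial>M) = ennreal ?P"
    using integrable_mult_L2[OF assms, THEN integrable_abs]
    by (subst nn_integral_eq_integral[symmetric]) (auto simp: ennreal_mult' abs_mult)
  also have "(\<integral>\<^sup>+x. (ennreal \<bar>f x\<bar>)\<^sup>2 \<partial>M) = ennreal (\<integral>x. (f x)\<^sup>2 \<partial>M)"
    using f by (subst nn_integral_eq_integral[symmetric]) (auto simp: ennreal_power)
  also have "(\<integral>\<^sup>+x. (ennreal \<bar>g x\<bar>)\<^sup>2 \<partial>M) = ennreal (\<integral>x. (g x)\<^sup>2 \<partial>M)"
    using g by (subst nn_integral_eq_integral[symmetric]) (auto simp: ennreal_power)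
  finally have "?P\<^sup>2 \<le> (\<integral>x. (f x)\<^sup>2 \<partial>M) * (\<integral>x. (g x)\<^sup>2 \<partial>M)"
    by (simp add: ennreal_power ennreal_mult'[symmetric])
  then have "?P \<le> sqrt (\<integral>x. (f x)\<^sup>2 \<partial>M) * sqrt (\<integral>x. (g x)\<^sup>2 \<partial>M)"
    by (simp add: real_le_rsqrt real_sqrt_mult[symmetric])
  then show ?thesis using integral_abs_bound[of M "\<lambda>x. f x * g x"] by linarith
qed

text \<open>A Borel version of an H1 function with its weak gradient. Borel measurability survives
  composition with (x, y) \<mapsto> x + y and with products, and \<open>lborel\<close> fits the
  Fubini theorems; the completed measure \<open>lebesgue\<close> in the given definitions is less
  convenient for both.\<close>

definition sobolev_pair :: "(real^3 \<Rightarrow> real) \<Rightarrow> (real^3 \<Rightarrow> real^3) \<Rightarrow> bool" where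
  "sobolev_pair u g \<longleftrightarrow> u \<in> borel_measurable borel \<and> g \<in> borel_measurable borel \<and>
     integrable lborel (\<lambda>x. (u x)\<^sup>2) \<and> integrable lborel (\<lambda>x. (norm (g x))\<^sup>2) \<and>
     (\<forall>\<psi>. test_function \<psi> \<longrightarrow> (\<forall>i.
        (\<integral>x. u x * frechet_derivative \<psi> (at x) (axis i 1) \<partial>lborel)
          = - (\<integral>x. (g x $ i) * \<psi> x \<partial>lborel)))"

lemma sobolev_pair_components:
  assumes "sobolev_pair u g"
  shows "u \<in> borel_measurable borel" "g \<in> borel_measurable borel"
    "integrable lborel (\<lambda>x. (u x)\<^sup>2)" "integrable lborel (\<lambda>x. (norm (g x))\<^sup>2)"
    "(\<lambda>x. g x \<bullet> y) \<in> borel_measurable borel" "integrable lborel (\<lambda>x. (g x \<bullet> y)\<^sup>2)"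
proof -
  show 1: "u \<in> borel_measurable borel" "g \<in> borel_measurable borel"
    "integrable lborel (\<lambda>x. (u x)\<^sup>2)" "integrable lborel (\<lambda>x. (norm (g x))\<^sup>2)"
    using assms by (auto simp: sobolev_pair_def)
  note [measurable] = 1(2)
  show "(\<lambda>x. g x \<bullet> y) \<in> borel_measurable borel" by measurable
  have "(g x \<bullet> y)\<^sup>2 \<le> (norm y)\<^sup>2 * (norm (g x))\<^sup>2" for x
    using power_mono[OF Cauchy_Schwarz_ineq2[of "g x" y], of 2]
    by (simp add: power_mult_distrib mult.commute)
  then show "integrable lborel (\<lambda>x. (g x \<bullet> y)\<^sup>2)"
    by (intro Bochner_Integration.integrable_bound[OF integrable_mult_right[OF 1(4), of "(norm y)\<^sup>2"]]) auto
qed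

lemma sobolev_pair_test:
  assumes "sobolev_pair u g" "test_function \<psi>"
  shows "(\<integral>x. u x * frechet_derivative \<psi> (at x) (axis i 1) \<partial>lborel) = - (\<integral>x. (g x $ i) * \<psi> x \<partial>lborel)"
  using assms by (simp add: sobolev_pair_def)

lemma sobolev_pair_component:
  assumes "sobolev_pair u g"
  shows "(\<lambda>x. g x $ i) \<in> borel_measurable borel" "integrable lborel (\<lambda>x. (g x $ i)\<^sup>2)"
proof -
  have "g x $ i = g x \<bullet> axis i 1" for x by (simp add: inner_axis)
  then show "(\<lambda>x. g x $ i) \<in> borel_measurable borel" "integrable lborel (\<lambda>x. (g x $ i)\<^sup>2)"
    using sobolev_pair_components(5,6)[OF assms, of "axis i 1"] by simp_all
qed

lemma integrable_mult_test_function: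
  assumes "w \<in> borel_measurable borel" "integrable lborel (\<lambda>x. (w x)\<^sup>2)" "test_function \<psi>"
  shows "integrable lborel (\<lambda>x. w x * \<psi> x)"
proof -
  obtain B R where "\<And>x. \<bar>\<psi> x\<bar> \<le> B * indicator (cball 0 R) x"
    using test_function_bound[OF assms(3)] by blast
  then show ?thesis
    by (rule integrable_mult_bounded_support[OF assms(1) test_function_borel[OF assms(3)] assms(2)])
qed

lemma test_function_L2:
  assumes "test_function \<psi>"
  shows "integrable lborel (\<lambda>x. (\<psi> x)\<^sup>2)"
proof -
  obtain B R where B: "0 \<le> B" "\<And>x. \<bar>\<psi> x\<bar> \<le> B * indicator (cball 0 R) x"
    using test_function_bound[OF assms] by metis
  have 1: "integrable lborel (\<lambda>x::real^3. B\<^sup>2 * indicator (cball 0 R) x :: real)"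
    by (intro integrable_mult_right integrable_real_indicator)
       (use emeasure_bounded_finite[of "cball (0::real^3) R"] in auto)
  have 2: "norm ((\<psi> x)\<^sup>2) \<le> norm (B\<^sup>2 * indicator (cball 0 R) x)" for x
    using power_mono[OF B(2)[of x], of 2] by (auto simp: indicator_def)
  have 3: "(\<lambda>x. (\<psi> x)\<^sup>2) \<in> borel_measurable lborel"
    using test_function_borel[OF assms] by simp
  show ?thesis
    by (rule Bochner_Integration.integrable_bound[OF 1 3 AE_I2[OF 2]])
qed

text \<open>The difference of two gradients integrates to 0 against every test function, so the
  duality bound holds with M = 0, componentwise.\<close>

lemma sobolev_pair_unique:
  assumes g: "sobolev_pair u g" and h: "sobolev_pair u h"
  shows "AE x in lborel. g x = h x"
proof -
  have "AE x in lborel. g x $ i = h x $ i" for i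
  proof -
    note gc = sobolev_pair_component[OF g, of i]
    note hc = sobolev_pair_component[OF h, of i]
    have eq: "(\<integral>x. (g x $ i - h x $ i) * \<psi> x \<partial>lborel) = 0" if "test_function \<psi>" for \<psi>
    proof -
      have "(\<integral>x. (g x $ i) * \<psi> x \<partial>lborel) = (\<integral>x. (h x $ i) * \<psi> x \<partial>lborel)"
      proof -
        have "- (\<integral>x. (g x $ i) * \<psi> x \<partial>lborel) = - (\<integral>x. (h x $ i) * \<psi> x \<partial>lborel)"
          using sobolev_pair_test[OF g that, of i] sobolev_pair_test[OF h that, of i] by (rule trans[OF sym])
        then show ?thesis by simp
      qed
      then show ?thesis
        using integrable_mult_test_function[OF gc that] integrable_mult_test_function[OF hc that]
        by (simp add: left_diff_distrib)
    qed
    have gh: "integrable lborel (\<lambda>x. g x $ i * h x $ i)"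
      by (rule integrable_mult_L2) (use gc hc in simp_all)
    have int: "integrable lborel (\<lambda>x. (g x $ i - h x $ i)\<^sup>2)"
      unfolding power2_diff mult.assoc
      using gc(2) hc(2) gh
      by (intro Bochner_Integration.integrable_diff Bochner_Integration.integrable_add integrable_mult_right)
    have "(\<integral>x. (g x $ i - h x $ i)\<^sup>2 \<partial>lborel) \<le> 0\<^sup>2"
    proof (rule L2_bound_by_test_functions[OF _ int])
      show "(\<lambda>x. g x $ i - h x $ i) \<in> borel_measurable borel"
        using gc(1) hc(1) by (rule borel_measurable_diff)
    qed (simp_all add: eq)
    then have "(\<integral>x. (g x $ i - h x $ i)\<^sup>2 \<partial>lborel) = 0"
      by (intro antisym) (simp_all add: integral_nonneg_AE)
    then have "AE x in lborel. (g x $ i - h x $ i)\<^sup>2 = 0"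
      using integral_nonneg_eq_0_iff_AE[OF int] by simp
    then show ?thesis by simp
  qed
  then have "AE x in lborel. \<forall>i. g x $ i = h x $ i" by (simp add: AE_all_countable)
  then show ?thesis by (simp add: vec_eq_iff)
qed

lemma bounded_linear_expansion:
  fixes l :: "real^'n \<Rightarrow> real"
  assumes "bounded_linear l"
  shows "l y = (\<Sum>i\<in>UNIV. y $ i * l (axis i 1))"
proof -
  have l: "linear l" using assms by (rule bounded_linear.linear)
  have "l y = l (\<Sum>i\<in>UNIV. y $ i *\<^sub>R axis i 1)"
    using basis_expansion[of y] by (simp only: scalar_mult_eq_scaleR)
  also have "\<dots> = (\<Sum>i\<in>UNIV. y $ i * l (axis i 1))"
    by (simp only: linear_sum[OF l] linear_scale[OF l] real_scaleR_def)
  finally show ?thesis .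
qed

lemma sobolev_pair_direction:
  assumes "sobolev_pair u g" "test_function \<psi>"
  shows "(\<integral>x. u x * frechet_derivative \<psi> (at x) y \<partial>lborel) = - (\<integral>x. (g x \<bullet> y) * \<psi> x \<partial>lborel)"
proof -
  note c = sobolev_pair_components[OF assms(1)]
  have "frechet_derivative \<psi> (at x) y = (\<Sum>i\<in>UNIV. y $ i * frechet_derivative \<psi> (at x) (axis i 1))" for x
    using has_derivative_bounded_linear[OF test_function_has_derivative[OF assms(2)]]
    by (rule bounded_linear_expansion)
  then have "(\<integral>x. u x * frechet_derivative \<psi> (at x) y \<partial>lborel) =
      (\<integral>x. (\<Sum>i\<in>UNIV. y $ i * (u x * frechet_derivative \<psi> (at x) (axis i 1))) \<partial>lborel)"
    by (simp add: sum_distrib_left ac_simps)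
  also have "\<dots> = (\<Sum>i\<in>UNIV. y $ i * (\<integral>x. u x * frechet_derivative \<psi> (at x) (axis i 1) \<partial>lborel))"
    using integrable_mult_test_function[OF c(1,3) test_function_frechet_derivative[OF assms(2)]]
    by (subst Bochner_Integration.integral_sum) auto
  also have "\<dots> = - (\<Sum>i\<in>UNIV. \<integral>x. y $ i * (g x $ i * \<psi> x) \<partial>lborel)"
    by (simp add: sobolev_pair_test[OF assms] sum_negf)
  also have "\<dots> = - (\<integral>x. (\<Sum>i\<in>UNIV. y $ i * (g x $ i * \<psi> x)) \<partial>lborel)"
    using integrable_mult_test_function[OF sobolev_pair_component[OF assms(1)] assms(2)]
    by (subst Bochner_Integration.integral_sum) simp_all
  also have "\<dots> = - (\<integral>x. (g x \<bullet> y) * \<psi> x \<partial>lborel)"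
    by (simp add: inner_vec_def sum_distrib_left ac_simps)
  finally show ?thesis .
qed

text \<open>The difference is moved onto the test function: the integral of (u(x + y) - u(x))
  \<psi>(x) equals that of u(x) (\<psi>(x - y) - \<psi>(x)). The smooth difference is an integral of
  the derivative along a segment; after Fubini the weak formulation turns that derivative into g
  \<bullet> y, and Cauchy-Schwarz followed by duality gives the bound.\<close>

lemma sobolev_pair_translation:
  assumes sp: "sobolev_pair u g"
  shows "integrable lborel (\<lambda>x. (u (x + y) - u x)\<^sup>2)"
    and "(\<integral>x. (u (x + y) - u x)\<^sup>2 \<partial>lborel) \<le> (norm y)\<^sup>2 * (\<integral>x. (norm (g x))\<^sup>2 \<partial>lborel)"
proof -
  note c = sobolev_pair_components[OF sp]
  note [measurable] = c(1,2)
  let ?G = "\<integral>x. (norm (g x))\<^sup>2 \<partial>lborel"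
  have G0: "0 \<le> ?G" by simp
  have shift: "integrable lborel (\<lambda>x. (u (x + y))\<^sup>2)"
    using c(3) lborel_integral_translate(2)[of "\<lambda>x. (u x)\<^sup>2" y] by simp
  have cross: "integrable lborel (\<lambda>x. u (x + y) * u x)"
    by (rule integrable_mult_L2[OF _ _ shift c(3)]) measurable
  show int: "integrable lborel (\<lambda>x. (u (x + y) - u x)\<^sup>2)"
    unfolding power2_diff mult.assoc
    by (intro Bochner_Integration.integrable_diff Bochner_Integration.integrable_add integrable_mult_right
        shift cross c(3))
  have "(\<integral>x. (u (x + y) - u x)\<^sup>2 \<partial>lborel) \<le> (norm y * sqrt ?G)\<^sup>2"
  proof (rule L2_bound_by_test_functions[OF _ int])
    fix \<psi> assume \<psi>: "test_function \<psi>"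
    define d where "d x = frechet_derivative \<psi> (at x) y" for x
    define K where "K = norm y * sqrt ?G * sqrt (\<integral>x. (\<psi> x)\<^sup>2 \<partial>lborel)"
    have d: "test_function d"
      unfolding d_def[abs_def] by (rule test_function_frechet_derivative[OF \<psi>])
    note [measurable] = test_function_borel[OF \<psi>] test_function_borel[OF d]
    obtain B R where B: "0 \<le> B" "\<And>x. \<bar>d x\<bar> \<le> B * indicator (cball 0 R) x"
      using test_function_bound[OF d] by metis
    have i1: "integrable lborel (\<lambda>x. u (x + y) * \<psi> x)"
      by (rule integrable_mult_test_function[OF _ shift \<psi>]) measurable
    have i2: "integrable lborel (\<lambda>x. u x * \<psi> x)"
      by (rule integrable_mult_test_function[OF c(1,3) \<psi>])
    have i3: "integrable lborel (\<lambda>x. u x * \<psi> (x - y))"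
      by (rule integrable_mult_test_function[OF c(1,3) test_function_shift[OF \<psi>]])
    have "(\<integral>x. u (x + y) * \<psi> x \<partial>lborel) = (\<integral>x. u x * \<psi> (x - y) \<partial>lborel)"
      using lborel_integral_translate(1)[of "\<lambda>x. u x * \<psi> (x - y)" y] by simp
    then have A1: "(\<integral>x. (u (x + y) - u x) * \<psi> x \<partial>lborel) = (\<integral>x. u x * (\<psi> (x - y) - \<psi> x) \<partial>lborel)"
      using i1 i2 i3 by (simp add: left_diff_distrib right_diff_distrib)
    have A2: "\<psi> (x - y) - \<psi> x = (\<integral>t. indicator {0..1} t *\<^sub>R (- d (x - t *\<^sub>R y)) \<partial>lborel)" for x
    proof (subst integral_FTC_Icc[where F = "\<lambda>t. \<psi> (x - t *\<^sub>R y)"])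
      fix t :: real
      have bl: "bounded_linear (frechet_derivative \<psi> (at (x - t *\<^sub>R y)))"
        by (rule has_derivative_bounded_linear[OF test_function_has_derivative[OF \<psi>]])
      have "((\<lambda>t. x - t *\<^sub>R y) has_derivative (\<lambda>h. - (h *\<^sub>R y))) (at t within {0..1})"
        by (auto intro!: derivative_eq_intros)
      from has_derivative_compose[OF this test_function_has_derivative[OF \<psi>]]
      show "((\<lambda>t. \<psi> (x - t *\<^sub>R y)) has_vector_derivative - d (x - t *\<^sub>R y)) (at t within {0..1})"
        unfolding has_vector_derivative_def d_def
        by (simp add: linear_neg[OF bounded_linear.linear[OF bl]] linear_scale[OF bounded_linear.linear[OF bl]])
    next
      show "continuous_on {0..1} (\<lambda>t. - d (x - t *\<^sub>R y))"
        by (intro continuous_intros continuous_on_compose2[OF test_function_continuous[OF d, of UNIV]]) auto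
    qed auto
    define h where "h x t = u x * (indicator {0..1} t *\<^sub>R (- d (x - t *\<^sub>R y)))" for x :: "real^3" and t :: real
    have hm: "case_prod h \<in> borel_measurable (lborel \<Otimes>\<^sub>M lborel)"
      unfolding h_def by measurable
    \<comment> \<open>An integrable majorant of \<open>h\<close>, which licenses Fubini: if x - t y
      lies in the ball of radius R and 0 \<le> t \<le> 1, then |x| \<le> R + |y|.\<close>
    define k where "k x t = u x * (B * indicator (cball 0 (R + norm y)) x) * indicator {0..1} t"
      for x :: "real^3" and t :: real
    have [measurable]: "cball (0::real^3) r \<in> sets borel" for r by simp
    have km: "case_prod k \<in> borel_measurable (lborel \<Otimes>\<^sub>M lborel)"
      unfolding k_def by measurable
    have lp: "pair_sigma_finite (lborel :: (real^3) measure) (lborel :: real measure)" ..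
    have ki: "integrable (lborel \<Otimes>\<^sub>M lborel) (case_prod k)"
    proof (rule pair_sigma_finite.Fubini_integrable[OF lp km])
      have "integrable lborel (\<lambda>x. u x * (B * indicator (cball 0 (R + norm y)) x))"
        by (rule integrable_mult_bounded_support[where B = B and R = "R + norm y"]) (use c B(1) in auto)
      from integrable_norm[OF this]
      show "integrable lborel (\<lambda>x. \<integral>t. norm (case_prod k (x, t)) \<partial>lborel)"
        by (simp add: k_def abs_mult)
      show "AE x in lborel. integrable lborel (\<lambda>t. case_prod k (x, t))"
        by (rule AE_I2) (simp add: k_def)
    qed
    have hi: "integrable (lborel \<Otimes>\<^sub>M lborel) (case_prod h)"
    proof (rule Bochner_Integration.integrable_bound[OF ki hm AE_I2])
      fix p :: "(real^3) \<times> real"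
      obtain x t where p: "p = (x, t)" by force
      have "\<bar>d (x - t *\<^sub>R y)\<bar> \<le> B * indicator (cball 0 (R + norm y)) x" if "t \<in> {0..1}"
      proof -
        have "norm x \<le> norm (x - t *\<^sub>R y) + norm (t *\<^sub>R y)"
          using norm_triangle_ineq[of "x - t *\<^sub>R y" "t *\<^sub>R y"] by simp
        moreover have "norm (t *\<^sub>R y) \<le> norm y" using that by (simp add: mult_left_le_one_le)
        ultimately have "B * indicator (cball 0 R) (x - t *\<^sub>R y) \<le> B * indicator (cball 0 (R + norm y)) x"
          using B(1) by (intro mult_left_mono) (auto simp: indicator_def)
        then show ?thesis using B(2) order.trans by blast
      qed
      then show "norm (case_prod h p) \<le> norm (case_prod k p)"
        using B(1) unfolding p h_def k_def by (auto simp: abs_mult indicator_def intro!: mult_left_mono split: if_splits)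
    qed
    \<comment> \<open>For fixed t the translate of \<psi> is itself a test function, so the weak
      formulation applies to it; its L^2 norm does not depend on t.\<close>
    have inner: "(\<integral>x. h x t \<partial>lborel) \<le> K * indicator {0..1} t" for t
    proof -
      let ?s = "\<lambda>x. \<psi> (x - t *\<^sub>R y)"
      have s: "test_function ?s" by (rule test_function_shift[OF \<psi>])
      have "frechet_derivative ?s (at x) = frechet_derivative \<psi> (at (x - t *\<^sub>R y))" for x
        by (rule frechet_derivative_at[symmetric], rule has_derivative_shift, rule test_function_has_derivative[OF \<psi>])
      then have "(\<integral>x. u x * d (x - t *\<^sub>R y) \<partial>lborel) = - (\<integral>x. (g x \<bullet> y) * ?s x \<partial>lborel)"
        using sobolev_pair_direction[OF sp s, of y] by (simp add: d_def)
      moreover have "(\<integral>x. (g x \<bullet> y) * ?s x \<partial>lborel) \<le> K"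
      proof -
        have "\<bar>\<integral>x. (g x \<bullet> y) * ?s x \<partial>lborel\<bar> \<le> sqrt (\<integral>x. (g x \<bullet> y)\<^sup>2 \<partial>lborel) * sqrt (\<integral>x. (?s x)\<^sup>2 \<partial>lborel)"
          by (rule integral_Cauchy_Schwarz) (use c(5,6) test_function_L2[OF s] in auto)
        also have "(\<integral>x. (?s x)\<^sup>2 \<partial>lborel) = (\<integral>x. (\<psi> x)\<^sup>2 \<partial>lborel)"
          using lborel_integral_translate(1)[of "\<lambda>x. (\<psi> x)\<^sup>2" "- (t *\<^sub>R y)"] by simp
        also have "(\<integral>x. (g x \<bullet> y)\<^sup>2 \<partial>lborel) \<le> (\<integral>x. (norm y)\<^sup>2 * (norm (g x))\<^sup>2 \<partial>lborel)"
        proof (rule integral_mono[OF c(6) integrable_mult_right[OF c(4)]])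
          show "(g x \<bullet> y)\<^sup>2 \<le> (norm y)\<^sup>2 * (norm (g x))\<^sup>2" for x
            using power_mono[OF Cauchy_Schwarz_ineq2[of "g x" y], of 2]
            by (simp add: power_mult_distrib mult.commute)
        qed
        finally show ?thesis
          unfolding K_def by (simp add: real_sqrt_mult mult_right_mono)
      qed
      ultimately show ?thesis by (auto simp: h_def indicator_def)
    qed
    have "(\<integral>x. u x * (\<psi> (x - y) - \<psi> x) \<partial>lborel) = (\<integral>x. (\<integral>t. h x t \<partial>lborel) \<partial>lborel)"
      unfolding A2 h_def by simp
    also have "\<dots> = (\<integral>t. (\<integral>x. h x t \<partial>lborel) \<partial>lborel)"
      by (rule pair_sigma_finite.Fubini_integral[OF lp hi, symmetric])
    also have "\<dots> \<le> (\<integral>t. K * indicator {0..1} t \<partial>(lborel :: real measure))"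
    proof (rule integral_mono)
      show "integrable lborel (\<lambda>t. \<integral>x. h x t \<partial>lborel)"
        by (rule pair_sigma_finite.integrable_snd[OF lp hi])
      show "integrable lborel (\<lambda>t::real. K * indicator {0..1} t)"
        by (intro integrable_mult_right integrable_real_indicator) auto
    qed (rule inner)
    also have "\<dots> = K" by simp
    finally show "(\<integral>x. (u (x + y) - u x) * \<psi> x \<partial>lborel) \<le> norm y * sqrt ?G * sqrt (\<integral>x. (\<psi> x)\<^sup>2 \<partial>lborel)"
      unfolding A1 K_def .
  qed (use G0 in auto)
  then show "(\<integral>x. (u (x + y) - u x)\<^sup>2 \<partial>lborel) \<le> (norm y)\<^sup>2 * ?G"
    using G0 by (simp add: power_mult_distrib)
qed

subsection \<open>Oscillation over balls\<close>

lemma ball_volume_3: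
  assumes "0 \<le> r"
  shows "measure lborel (ball (x::real^3) r) = 4 / 3 * pi * r ^ 3"
  using sphere_volume[OF assms, of x] by simp

lemma emeasure_ball_3:
  assumes "0 \<le> r"
  shows "emeasure lborel (ball (x::real^3) r) = ennreal (4 / 3 * pi * r ^ 3)"
  using emeasure_bounded_finite[of "ball x r"] ball_volume_3[OF assms, of x]
  by (metis bounded_ball emeasure_eq_ennreal_measure less_irrefl infinity_ennreal_def)

text \<open>The local oscillation is not divided by the volume of the ball, and it takes values in
  \<open>ennreal\<close> so that Tonelli applies before any finiteness is known.\<close>

definition osc :: "(real^3 \<Rightarrow> real) \<Rightarrow> real \<Rightarrow> real^3 \<Rightarrow> ennreal" where
  "osc u r x = (\<integral>\<^sup>+y. ennreal ((u (x + y) - u x)\<^sup>2) * indicator (ball 0 r) y \<partial>lborel)"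

lemma osc_measurable:
  assumes [measurable]: "u \<in> borel_measurable borel"
  shows "osc u r \<in> borel_measurable borel"
proof -
  have [measurable]: "ball (0::real^3) r \<in> sets borel" by simp
  have "osc u r \<in> borel_measurable lborel"
    unfolding osc_def[abs_def] by (rule lborel.borel_measurable_nn_integral) measurable
  then show ?thesis by simp
qed

text \<open>After exchanging the integrals, each shift y with |y| < r contributes at most r^2 S by
  the translation estimate; the remaining factor is the volume of the ball.\<close>

lemma nn_integral_osc_le:
  assumes sp: "sobolev_pair u g" and S: "(\<integral>x. (norm (g x))\<^sup>2 \<partial>lborel) \<le> S" and "0 \<le> r"
  shows "(\<integral>\<^sup>+x. osc u r x \<partial>lborel) \<le> ennreal (4 / 3 * pi * r ^ 3 * (r\<^sup>2 * S))"
proof -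
  have [measurable]: "u \<in> borel_measurable borel" using sobolev_pair_components(1)[OF sp] .
  have [measurable]: "ball (0::real^3) r \<in> sets borel" by simp
  have S0: "0 \<le> S" using S by (rule order.trans[rotated]) simp
  have "(\<integral>\<^sup>+x. osc u r x \<partial>lborel) =
      (\<integral>\<^sup>+y. \<integral>\<^sup>+x. ennreal ((u (x + y) - u x)\<^sup>2) * indicator (ball 0 r) y \<partial>lborel \<partial>lborel)"
    unfolding osc_def by (rule lborel_pair.Fubini'[symmetric]) measurable
  also have "\<dots> \<le> (\<integral>\<^sup>+y. ennreal (r\<^sup>2 * S) * indicator (ball 0 r) y \<partial>(lborel :: (real^3) measure))"
  proof (rule nn_integral_mono)
    fix y :: "real^3"
    show "(\<integral>\<^sup>+x. ennreal ((u (x + y) - u x)\<^sup>2) * indicator (ball 0 r) y \<partial>lborel)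
        \<le> ennreal (r\<^sup>2 * S) * indicator (ball 0 r) y"
    proof (cases "norm y < r")
      case True
      have "(\<integral>\<^sup>+x. ennreal ((u (x + y) - u x)\<^sup>2) \<partial>lborel) = ennreal (\<integral>x. (u (x + y) - u x)\<^sup>2 \<partial>lborel)"
        by (rule nn_integral_eq_integral[OF sobolev_pair_translation(1)[OF sp]]) simp
      also have "\<dots> \<le> ennreal (r\<^sup>2 * S)"
      proof (rule ennreal_leI, rule order.trans[OF sobolev_pair_translation(2)[OF sp]])
        show "(norm y)\<^sup>2 * (\<integral>x. (norm (g x))\<^sup>2 \<partial>lborel) \<le> r\<^sup>2 * S"
          using True S S0 by (intro mult_mono power_mono) auto
      qed
      finally show ?thesis using True by simp
    qed simp
  qed
  also have "\<dots> = ennreal (r\<^sup>2 * S) * emeasure lborel (ball (0::real^3) r)"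
    by (rule nn_integral_cmult_indicator) simp
  also have "\<dots> = ennreal (4 / 3 * pi * r ^ 3 * (r\<^sup>2 * S))"
    using \<open>0 \<le> r\<close> S0 by (simp add: emeasure_ball_3 ennreal_mult'[symmetric] mult.commute)
  finally show ?thesis .
qed

text \<open>The value u(x) is compared with u(x + y) and averaged over the ball of radius r. In the
  term free of u(x) the ball is enlarged to the whole space, leaving S / V.\<close>

lemma square_le_osc:
  assumes [measurable]: "u \<in> borel_measurable borel" and "integrable lborel (\<lambda>x. (u x)\<^sup>2)"
    and S: "(\<integral>x. (u x)\<^sup>2 \<partial>lborel) \<le> S" and "0 < r" and V: "V = 4 / 3 * pi * r ^ 3"
  shows "ennreal ((u x)\<^sup>2) \<le> ennreal (2 / V) * osc u r x + ennreal (2 * S / V)"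
proof -
  have [measurable]: "ball (0::real^3) r \<in> sets borel" by simp
  have S0: "0 \<le> S" using S by (rule order.trans[rotated]) simp
  have V0: "0 < V" using \<open>0 < r\<close> by (simp add: V)
  have "ennreal ((u x)\<^sup>2) * ennreal V = (\<integral>\<^sup>+y. ennreal ((u x)\<^sup>2) * indicator (ball 0 r) y \<partial>(lborel :: (real^3) measure))"
    using \<open>0 < r\<close> by (subst nn_integral_cmult_indicator) (auto simp: emeasure_ball_3 V)
  also have "\<dots> \<le> (\<integral>\<^sup>+y. 2 * (ennreal ((u (x + y) - u x)\<^sup>2) * indicator (ball 0 r) y) + 2 * ennreal ((u (x + y))\<^sup>2) \<partial>lborel)"
  proof (rule nn_integral_mono)
    fix y :: "real^3"
    \<comment> \<open>The right-hand side minus the left-hand side is (2 b - a)^2.\<close>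
    have "a\<^sup>2 \<le> 2 * (b - a)\<^sup>2 + 2 * b\<^sup>2" for a b :: real
      using zero_le_power2[of "2 * b - a"] by (simp add: power2_diff power2_eq_square algebra_simps)
    then have "ennreal ((u x)\<^sup>2) \<le> ennreal (2 * (u (x + y) - u x)\<^sup>2 + 2 * (u (x + y))\<^sup>2)"
      by (rule ennreal_leI)
    also have "\<dots> = 2 * ennreal ((u (x + y) - u x)\<^sup>2) + 2 * ennreal ((u (x + y))\<^sup>2)"
      by (simp add: ennreal_mult')
    finally show "ennreal ((u x)\<^sup>2) * indicator (ball 0 r) y
        \<le> 2 * (ennreal ((u (x + y) - u x)\<^sup>2) * indicator (ball 0 r) y) + 2 * ennreal ((u (x + y))\<^sup>2)"
      by (auto simp: indicator_def)
  qed
  also have "\<dots> = 2 * osc u r x + 2 * (\<integral>\<^sup>+y. ennreal ((u (x + y))\<^sup>2) \<partial>lborel)"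
    unfolding osc_def by (simp add: nn_integral_add nn_integral_cmult)
  also have "(\<integral>\<^sup>+y. ennreal ((u (x + y))\<^sup>2) \<partial>lborel) = (\<integral>\<^sup>+y. ennreal ((u y)\<^sup>2) \<partial>lborel)"
    using lborel_integral_translate(3)[of "\<lambda>y. (u y)\<^sup>2" x] by (simp add: add.commute)
  also have "\<dots> = ennreal (\<integral>y. (u y)\<^sup>2 \<partial>lborel)"
    by (rule nn_integral_eq_integral) (use assms in auto)
  also have "2 * osc u r x + 2 * \<dots> \<le> 2 * osc u r x + 2 * ennreal S"
    by (intro add_left_mono mult_left_mono ennreal_leI S) simp
  finally have "ennreal (1 / V) * (ennreal ((u x)\<^sup>2) * ennreal V) \<le> ennreal (1 / V) * (2 * osc u r x + 2 * ennreal S)"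
    by (rule mult_left_mono) simp
  also have "ennreal (1 / V) * (ennreal ((u x)\<^sup>2) * ennreal V) = ennreal ((u x)\<^sup>2)"
    using V0 by (simp add: ennreal_mult'[symmetric] mult.commute)
  also have "ennreal (1 / V) * (2 * osc u r x + 2 * ennreal S) = ennreal (2 / V) * osc u r x + ennreal (2 * S / V)"
  proof -
    have "ennreal (1 / V) * 2 = ennreal (2 / V)"
      using V0 ennreal_mult'[of "2" "1 / V"] by (simp add: mult.commute)
    moreover have "ennreal (2 / V) * ennreal S = ennreal (2 * S / V)"
      using V0 S0 by (simp add: ennreal_mult'[symmetric])
    ultimately show ?thesis by (simp add: distrib_left mult.assoc[symmetric])
  qed
  finally show ?thesis .
qed

section \<open>Summation over geometric scales: the cubic norm and the Coulomb potential\<close>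

lemma power_interval_exists:
  fixes a b :: real
  assumes "1 < b" "1 \<le> a"
  obtains k where "b ^ k \<le> a" "a < b ^ Suc k"
proof -
  obtain n where "a < b ^ n" using real_arch_pow[OF assms(1)] by blast
  then obtain m where m: "\<forall>i<m. \<not> a < b ^ i" "a < b ^ m"
    using ex_least_nat_le[of "\<lambda>n. a < b ^ n" n] by blast
  then have "m \<noteq> 0" using assms(2) by (intro notI) simp
  then obtain k where "m = Suc k" using not0_implies_Suc by blast
  then show thesis using that m by (metis lessI not_less)
qed

lemma term_le_suminf_ennreal: "f k \<le> (\<Sum>k. f k)" for f :: "nat \<Rightarrow> ennreal"
  using sum_le_suminf[of f "{k}"] by simp

lemma suminf_ennreal_half_powers:
  "0 \<le> a \<Longrightarrow> (\<Sum>k. ennreal (a * (1 / 2) ^ k)) = ennreal (2 * a)"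
  using sums_mult[OF geometric_sums[of "1 / 2 :: real"], of a]
  by (intro suminf_ennreal_eq) (auto simp: mult.commute)

text \<open>The cube norm is controlled by comparing \<open>u\<close> with its averages over balls: where
  \<open>8\<^sup>k \<le> \<bar>u\<bar>\<close>, the average over a ball of radius \<open>c / 4\<^sup>k\<close> is too small to account for the value of \<open>u\<close>,
  so the oscillation dominates, and the resulting geometric series converges.\<close>

lemma nn_integral_cube_le:
  assumes sp: "sobolev_pair u g"
    and Su: "(\<integral>x. (u x)\<^sup>2 \<partial>lborel) \<le> S" and Sg: "(\<integral>x. (norm (g x))\<^sup>2 \<partial>lborel) \<le> S"
    and c: "1 \<le> c" "S \<le> c ^ 3"
  shows "(\<integral>\<^sup>+x. ennreal (\<bar>u x\<bar> ^ 3) \<partial>lborel) \<le> ennreal ((1 + 64 * c\<^sup>2) * S)"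
proof -
  note comp = sobolev_pair_components[OF sp]
  note [measurable] = comp(1) osc_measurable[OF comp(1)]
  have S0: "0 \<le> S" using Su by (rule order.trans[rotated]) simp
  \<comment> \<open>On the level 8^k \<le> |u| the square is at least 64^k, while a mean square over
    a ball of radius r is of order S / r^3 at most. With S \<le> c^3 the radius c / 4^k is where the
    two balance.\<close>
  define r where "r k = c / 4 ^ k" for k :: nat
  define V where "V k = 4 / 3 * pi * r k ^ 3" for k
  have r0: "0 < r k" for k using c by (simp add: r_def)
  have V0: "0 < V k" for k using r0 by (simp add: V_def)
  \<comment> \<open>The factor 4 makes the average term 2 S / V at most half of u^2, so that it can
    be absorbed; it comes from \<pi> > 3.\<close>
  have V_ge: "4 * S \<le> V k * 64 ^ k" for k
  proof -
    have "((4::real) ^ k) ^ 3 = (4 ^ 3) ^ k"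
      by (simp only: power_mult[symmetric] mult.commute[of k])
    then have "V k * 64 ^ k = 4 / 3 * pi * c ^ 3"
      by (simp add: V_def r_def power_divide)
    moreover have "4 * c ^ 3 \<le> 4 / 3 * pi * c ^ 3"
      using pi_gt3 c by (intro mult_right_mono) auto
    ultimately show ?thesis using c by linarith
  qed
  have pt: "ennreal (\<bar>u x\<bar> ^ 3) \<le> ennreal ((u x)\<^sup>2) + (\<Sum>k. ennreal (32 * 8 ^ k / V k) * osc u (r k) x)" for x
  proof (cases "\<bar>u x\<bar> < 1")
    case True
    have "\<bar>u x\<bar> ^ 3 \<le> \<bar>u x\<bar> ^ 2" using True by (intro power_decreasing) auto
    then have "ennreal (\<bar>u x\<bar> ^ 3) \<le> ennreal ((u x)\<^sup>2)" by (intro ennreal_leI) simp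
    then show ?thesis by (rule add_increasing2[rotated]) simp
  next
    case False
    then obtain k where k: "8 ^ k \<le> \<bar>u x\<bar>" "\<bar>u x\<bar> < 8 ^ Suc k"
      using power_interval_exists[of 8 "\<bar>u x\<bar>"] by auto
    have "(8 ^ k)\<^sup>2 \<le> \<bar>u x\<bar>\<^sup>2" by (rule power_mono[OF k(1)]) simp
    then have u64: "64 ^ k \<le> (u x)\<^sup>2"
      by (simp add: power_mult[symmetric] mult.commute[of k] power_mult[of "8::real" 2])
    have "4 * S \<le> V k * (u x)\<^sup>2"
      using V_ge[of k] mult_left_mono[OF u64, of "V k"] V0[of k] by linarith
    then have half: "2 * S / V k \<le> (u x)\<^sup>2 / 2" using V0[of k] by (simp add: field_simps)
    \<comment> \<open>Absorbing half of u^2 needs a subtraction, which is carried out in the reals;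
      for infinite oscillation the claim is trivial.\<close>
    have osc: "ennreal ((u x)\<^sup>2) \<le> ennreal (4 / V k) * osc u (r k) x"
    proof (cases "osc u (r k) x")
      case (real e)
      have "ennreal ((u x)\<^sup>2) \<le> ennreal (2 / V k) * osc u (r k) x + ennreal (2 * S / V k)"
        by (rule square_le_osc[OF comp(1,3) Su r0 V_def])
      also have "\<dots> = ennreal (2 / V k * e + 2 * S / V k)"
        using real V0[of k] S0 by (simp add: ennreal_mult'[symmetric])
      finally have "(u x)\<^sup>2 \<le> 2 / V k * e + 2 * S / V k"
        using real V0[of k] S0 by (subst (asm) ennreal_le_iff) auto
      moreover have "4 / V k * e = 2 * (2 / V k * e)" by simp
      ultimately have "(u x)\<^sup>2 \<le> 4 / V k * e" using half by linarith
      then show ?thesis using real V0[of k] by (simp add: ennreal_mult'[symmetric] ennreal_leI)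
    next
      case top
      then show ?thesis using V0[of k] by (simp add: ennreal_mult_top)
    qed
    have "\<bar>u x\<bar> ^ 3 = \<bar>u x\<bar> * (u x)\<^sup>2" by (simp add: power3_eq_cube power2_eq_square)
    also have "\<dots> \<le> 8 ^ Suc k * (u x)\<^sup>2" using k(2) by (intro mult_right_mono) auto
    finally have "ennreal (\<bar>u x\<bar> ^ 3) \<le> ennreal (8 ^ Suc k) * ennreal ((u x)\<^sup>2)"
      by (simp add: ennreal_mult'[symmetric] ennreal_leI)
    also have "\<dots> \<le> ennreal (8 ^ Suc k) * (ennreal (4 / V k) * osc u (r k) x)"
      by (intro mult_left_mono osc) simp
    also have "\<dots> = ennreal (32 * 8 ^ k / V k) * osc u (r k) x"
      using V0[of k] by (simp add: mult.assoc[symmetric] ennreal_mult'[symmetric])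
    also have "\<dots> \<le> (\<Sum>k. ennreal (32 * 8 ^ k / V k) * osc u (r k) x)"
      by (rule term_le_suminf_ennreal[of "\<lambda>k. ennreal (32 * 8 ^ k / V k) * osc u (r k) x"])
    finally show ?thesis by (rule add_increasing[rotated]) simp
  qed
  have "(\<integral>\<^sup>+x. ennreal (\<bar>u x\<bar> ^ 3) \<partial>lborel)
      \<le> (\<integral>\<^sup>+x. ennreal ((u x)\<^sup>2) + (\<Sum>k. ennreal (32 * 8 ^ k / V k) * osc u (r k) x) \<partial>lborel)"
    by (rule nn_integral_mono) (rule pt)
  also have "\<dots> = (\<integral>\<^sup>+x. ennreal ((u x)\<^sup>2) \<partial>lborel) +
      (\<Sum>k. ennreal (32 * 8 ^ k / V k) * (\<integral>\<^sup>+x. osc u (r k) x \<partial>lborel))"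
    by (subst nn_integral_add) (auto simp: nn_integral_suminf nn_integral_cmult)
  also have "\<dots> \<le> ennreal S + (\<Sum>k. ennreal (32 * c\<^sup>2 * S * (1 / 2) ^ k))"
  proof (intro add_mono suminf_le allI summableI)
    have "(\<integral>\<^sup>+x. ennreal ((u x)\<^sup>2) \<partial>lborel) = ennreal (\<integral>x. (u x)\<^sup>2 \<partial>lborel)"
      by (rule nn_integral_eq_integral[OF comp(3)]) simp
    then show "(\<integral>\<^sup>+x. ennreal ((u x)\<^sup>2) \<partial>lborel) \<le> ennreal S" using Su by (simp add: ennreal_leI)
    fix k
    have "ennreal (32 * 8 ^ k / V k) * (\<integral>\<^sup>+x. osc u (r k) x \<partial>lborel)
        \<le> ennreal (32 * 8 ^ k / V k) * ennreal (V k * ((r k)\<^sup>2 * S))"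
      using nn_integral_osc_le[OF sp Sg less_imp_le[OF r0], of k]
      by (intro mult_left_mono) (simp_all add: V_def)
    also have "\<dots> = ennreal (32 * 8 ^ k * ((r k)\<^sup>2 * S))"
      using V0[of k] by (simp add: ennreal_mult'[symmetric] mult.assoc)
    \<comment> \<open>The volumes have cancelled. The level contributes 8^k and the squared radius
      c^2 / 16^k, whence the ratio 1/2.\<close>
    also have "32 * 8 ^ k * ((r k)\<^sup>2 * S) = 32 * c\<^sup>2 * S * (1 / 2) ^ k"
    proof -
      have "((4::real) ^ k)\<^sup>2 = (4\<^sup>2) ^ k"
        by (simp only: power_mult[symmetric] mult.commute[of k])
      then have "(8::real) ^ k / (4 ^ k)\<^sup>2 = (8 / 4\<^sup>2) ^ k" by (simp only: power_divide)
      then have "(8::real) ^ k / (4 ^ k)\<^sup>2 = (1 / 2) ^ k" by simp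
      moreover have "32 * 8 ^ k * ((r k)\<^sup>2 * S) = 32 * c\<^sup>2 * S * (8 ^ k / (4 ^ k)\<^sup>2)"
        by (simp add: r_def power_divide)
      ultimately show ?thesis by (simp only:)
    qed
    finally show "ennreal (32 * 8 ^ k / V k) * (\<integral>\<^sup>+x. osc u (r k) x \<partial>lborel) \<le> ennreal (32 * c\<^sup>2 * S * (1 / 2) ^ k)" .
  qed
  also have "\<dots> = ennreal ((1 + 64 * c\<^sup>2) * S)"
    using S0 by (subst suminf_ennreal_half_powers) (auto simp: distrib_right ennreal_plus[symmetric] simp del: ennreal_plus)
  finally show ?thesis .
qed

text \<open>The radius s of the ball and the comparison scale r are independent: the oscillation
  costs r^2, the average costs (s / r)^3. Choosing s much smaller than r, and r small, makes both
  small.\<close>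

lemma nn_integral_square_ball_le:
  assumes sp: "sobolev_pair u g"
    and Su: "(\<integral>x. (u x)\<^sup>2 \<partial>lborel) \<le> S" and Sg: "(\<integral>x. (norm (g x))\<^sup>2 \<partial>lborel) \<le> S"
    and "0 < r" "0 \<le> s"
  shows "(\<integral>\<^sup>+y. ennreal ((u y)\<^sup>2) * indicator (ball x s) y \<partial>lborel) \<le> ennreal (2 * S * (r\<^sup>2 + s ^ 3 / r ^ 3))"
proof -
  note comp = sobolev_pair_components[OF sp]
  note [measurable] = comp(1) osc_measurable[OF comp(1)]
  have [measurable]: "ball x s \<in> sets borel" by simp
  have S0: "0 \<le> S" using Su by (rule order.trans[rotated]) simp
  define V where "V = 4 / 3 * pi * r ^ 3"
  have V0: "0 < V" using \<open>0 < r\<close> by (simp add: V_def)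
  have "(\<integral>\<^sup>+y. ennreal ((u y)\<^sup>2) * indicator (ball x s) y \<partial>lborel)
      \<le> (\<integral>\<^sup>+y. ennreal (2 / V) * osc u r y + ennreal (2 * S / V) * indicator (ball x s) y \<partial>lborel)"
    using square_le_osc[OF comp(1,3) Su \<open>0 < r\<close> V_def] by (intro nn_integral_mono) (auto simp: indicator_def)
  also have "\<dots> = ennreal (2 / V) * (\<integral>\<^sup>+y. osc u r y \<partial>lborel) + ennreal (2 * S / V) * emeasure lborel (ball x s)"
    by (simp add: nn_integral_add nn_integral_cmult nn_integral_cmult_indicator)
  also have "\<dots> \<le> ennreal (2 / V) * ennreal (V * (r\<^sup>2 * S)) + ennreal (2 * S / V) * ennreal (4 / 3 * pi * s ^ 3)"
    using nn_integral_osc_le[OF sp Sg, of r] \<open>0 < r\<close> \<open>0 \<le> s\<close>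
    by (intro add_mono mult_left_mono) (auto simp: V_def emeasure_ball_3)
  also have "\<dots> = ennreal (2 * S * (r\<^sup>2 + s ^ 3 / r ^ 3))"
  proof -
    have "ennreal (2 / V) * ennreal (V * (r\<^sup>2 * S)) = ennreal (2 * (r\<^sup>2 * S))"
      using V0 by (simp add: ennreal_mult'[symmetric])
    moreover have "ennreal (2 * S / V) * ennreal (4 / 3 * pi * s ^ 3) = ennreal (2 * S * (s ^ 3 / r ^ 3))"
    proof -
      have "2 * S / V * (4 / 3 * pi * s ^ 3) = 2 * S * (s ^ 3 / r ^ 3)"
        using \<open>0 < r\<close> by (simp add: V_def field_simps)
      then show ?thesis using V0 S0 by (metis ennreal_mult' divide_nonneg_pos mult_nonneg_nonneg zero_le_numeral)
    qed
    ultimately show ?thesis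
      using S0 \<open>0 < r\<close> \<open>0 \<le> s\<close> by (simp add: ennreal_plus[symmetric] algebra_simps del: ennreal_plus)
  qed
  finally show ?thesis .
qed

text \<open>Away from x the kernel is at most 1. Near x the ball is cut into shells of ratio 32; the
  kernel grows by 32 per shell while the mass in the concentric balls decays by 64. The total is S +
  2 * 128 S.\<close>

lemma nn_integral_coulomb_le:
  assumes sp: "sobolev_pair u g"
    and Su: "(\<integral>x. (u x)\<^sup>2 \<partial>lborel) \<le> S" and Sg: "(\<integral>x. (norm (g x))\<^sup>2 \<partial>lborel) \<le> S"
  shows "(\<integral>\<^sup>+y. ennreal ((u y)\<^sup>2 / norm (x - y)) \<partial>lborel) \<le> ennreal (257 * S)"
proof -
  note comp = sobolev_pair_components[OF sp]
  note [measurable] = comp(1)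
  have [measurable]: "ball x s \<in> sets borel" for s by simp
  have S0: "0 \<le> S" using Su by (rule order.trans[rotated]) simp
  let ?s = "\<lambda>k::nat. (1 / 32) ^ k :: real"
  let ?f = "\<lambda>k y. ennreal (32 ^ Suc k) * (ennreal ((u y)\<^sup>2) * indicator (ball x (?s k)) y)"
  have pt: "ennreal ((u y)\<^sup>2 / norm (x - y)) \<le> ennreal ((u y)\<^sup>2) + (\<Sum>k. ?f k y)" for y
  proof -
    consider "x = y" | "1 \<le> norm (x - y)" | "0 < norm (x - y)" "norm (x - y) < 1" by fastforce
    then show ?thesis
    proof cases
      case 1
      then show ?thesis by simp
    next
      case 2
      then have "(u y)\<^sup>2 / norm (x - y) \<le> (u y)\<^sup>2 / 1" by (intro divide_left_mono) auto
      then have "ennreal ((u y)\<^sup>2 / norm (x - y)) \<le> ennreal ((u y)\<^sup>2)" by (simp add: ennreal_leI)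
      then show ?thesis by (rule add_increasing2[rotated]) simp
    next
      case 3
      then obtain k where k: "32 ^ k \<le> 1 / norm (x - y)" "1 / norm (x - y) < 32 ^ Suc k"
        using power_interval_exists[of 32 "1 / norm (x - y)"] by (auto simp: field_simps)
      show ?thesis
      proof (cases "norm (x - y) < ?s k")
        case True
        have "(u y)\<^sup>2 * (1 / norm (x - y)) \<le> (u y)\<^sup>2 * 32 ^ Suc k"
          using k(2) by (intro mult_left_mono) auto
        then have "ennreal ((u y)\<^sup>2 / norm (x - y)) \<le> ennreal (32 ^ Suc k * (u y)\<^sup>2)"
          by (intro ennreal_leI) (simp add: mult.commute)
        also have "\<dots> = ?f k y" using True by (simp add: ennreal_mult' dist_norm)
        also have "\<dots> \<le> (\<Sum>k. ?f k y)" by (rule term_le_suminf_ennreal[of "\<lambda>k. ?f k y"])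
        finally show ?thesis by (rule add_increasing[rotated]) simp
      next
        \<comment> \<open>Only the boundary |x - y| = 32^(-k), which the open ball misses, is left.
          There the previous index j = k - 1 serves, with equality; k = 0 is excluded by |x - y| <
          1.\<close>
        case False
        then have eq: "1 / norm (x - y) = 32 ^ k"
          using k(1) 3 by (intro antisym) (auto simp: power_divide field_simps)
        show ?thesis
        proof (cases k)
          case 0
          then show ?thesis using eq 3 by simp
        next
          case (Suc j)
          have "norm (x - y) * 32 ^ k = 1" using 3 by (simp add: eq[symmetric])
          then have "norm (x - y) = ?s k" by (simp add: field_simps power_divide)
          then have "norm (x - y) * 32 = ?s j" unfolding Suc by simp
          then have "norm (x - y) < ?s j" using 3 by linarith
          moreover have "(u y)\<^sup>2 / norm (x - y) = 32 ^ Suc j * (u y)\<^sup>2"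
            using eq unfolding Suc by (metis mult.commute mult.right_neutral times_divide_eq_right)
          ultimately have "ennreal ((u y)\<^sup>2 / norm (x - y)) = ?f j y"
            by (simp only: ennreal_mult' zero_le_power zero_le_numeral indicator_simps mem_ball dist_norm mult_1_right)
          also have "\<dots> \<le> (\<Sum>k. ?f k y)" by (rule term_le_suminf_ennreal[of "\<lambda>k. ?f k y"])
          finally show ?thesis by (rule add_increasing[rotated]) simp
        qed
      qed
    qed
  qed
  have "(\<integral>\<^sup>+y. ennreal ((u y)\<^sup>2 / norm (x - y)) \<partial>lborel) \<le> (\<integral>\<^sup>+y. ennreal ((u y)\<^sup>2) + (\<Sum>k. ?f k y) \<partial>lborel)"
    by (rule nn_integral_mono) (rule pt)
  also have "\<dots> = (\<integral>\<^sup>+y. ennreal ((u y)\<^sup>2) \<partial>lborel) +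
      (\<Sum>k. ennreal (32 ^ Suc k) * (\<integral>\<^sup>+y. ennreal ((u y)\<^sup>2) * indicator (ball x (?s k)) y \<partial>lborel))"
    by (subst nn_integral_add) (auto simp: nn_integral_suminf nn_integral_cmult)
  also have "\<dots> \<le> ennreal S + (\<Sum>k. ennreal (128 * S * (1 / 2) ^ k))"
  proof (intro add_mono suminf_le allI summableI)
    have "(\<integral>\<^sup>+x. ennreal ((u x)\<^sup>2) \<partial>lborel) = ennreal (\<integral>x. (u x)\<^sup>2 \<partial>lborel)"
      by (rule nn_integral_eq_integral[OF comp(3)]) simp
    then show "(\<integral>\<^sup>+x. ennreal ((u x)\<^sup>2) \<partial>lborel) \<le> ennreal S" using Su by (simp add: ennreal_leI)
    fix k
    \<comment> \<open>For s = 32^(-k) the comparison scale r = 8^(-k) equalises the two errors: r^2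
      and (s / r)^3 are both 64^(-k).\<close>
    have "(\<integral>\<^sup>+y. ennreal ((u y)\<^sup>2) * indicator (ball x (?s k)) y \<partial>lborel)
        \<le> ennreal (2 * S * (((1 / 8) ^ k)\<^sup>2 + ?s k ^ 3 / ((1 / 8) ^ k) ^ 3))"
      by (rule nn_integral_square_ball_le[OF sp Su Sg]) auto
    also have "((1 / 8) ^ k)\<^sup>2 + ?s k ^ 3 / ((1 / 8) ^ k) ^ 3 = 2 * (1 / 64 :: real) ^ k"
    proof -
      have "((1 / 8 :: real) ^ k)\<^sup>2 = (1 / 64) ^ k"
      proof -
        have "((1 / 8 :: real) ^ k)\<^sup>2 = ((1 / 8)\<^sup>2) ^ k"
          by (simp only: power_mult[symmetric] mult.commute[of k])
        then show ?thesis by (simp add: power2_eq_square)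
      qed
      moreover have "?s k ^ 3 / ((1 / 8) ^ k) ^ 3 = ((1 / 32) ^ 3 / (1 / 8) ^ 3 :: real) ^ k"
        by (simp only: power_divide[symmetric] power_mult[symmetric] mult.commute[of k])
      ultimately show ?thesis by (simp add: power_divide)
    qed
    finally have "ennreal (32 ^ Suc k) * (\<integral>\<^sup>+y. ennreal ((u y)\<^sup>2) * indicator (ball x (?s k)) y \<partial>lborel)
        \<le> ennreal (32 ^ Suc k) * ennreal (2 * S * (2 * (1 / 64) ^ k))"
      by (rule mult_left_mono) simp
    also have "\<dots> = ennreal (32 ^ Suc k * (2 * S * (2 * (1 / 64) ^ k)))"
      by (rule ennreal_mult'[symmetric]) simp
    also have "32 ^ Suc k * (2 * S * (2 * (1 / 64) ^ k)) = 128 * S * (32 * (1 / 64)) ^ k"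
      by (simp only: power_mult_distrib power_Suc) simp
    finally show "ennreal (32 ^ Suc k) * (\<integral>\<^sup>+y. ennreal ((u y)\<^sup>2) * indicator (ball x (?s k)) y \<partial>lborel)
        \<le> ennreal (128 * S * (1 / 2) ^ k)" by simp
  qed
  also have "\<dots> = ennreal (257 * S)"
    using S0 by (subst suminf_ennreal_half_powers) (auto simp: ennreal_plus[symmetric] simp del: ennreal_plus)
  finally show ?thesis .
qed

subsection \<open>The space H1\<close>

lemma integral_lebesgue_lborel:
  fixes F G :: "real^3 \<Rightarrow> real"
  assumes G: "G \<in> borel_measurable borel" and ae: "AE x in lborel. F x = G x"
  shows "(\<integral>x. F x \<partial>lebesgue) = (\<integral>x. G x \<partial>lborel)"
    and "integrable lebesgue F \<longleftrightarrow> integrable lborel G"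
    and "F \<in> borel_measurable lebesgue"
proof -
  have G': "G \<in> borel_measurable lborel" using G by simp
  have Gl: "G \<in> borel_measurable lebesgue" by (rule measurable_completion[OF G'])
  have ae': "AE x in lebesgue. F x = G x" using ae by (rule AE_completion)
  then have "AE x in lebesgue. G x = F x" by (rule AE_mp) simp
  then show Fm: "F \<in> borel_measurable lebesgue" by (rule borel_measurable_AE[OF Gl])
  show "(\<integral>x. F x \<partial>lebesgue) = (\<integral>x. G x \<partial>lborel)"
    using integral_cong_AE[OF Fm Gl ae'] integral_completion[OF G'] by simp
  show "integrable lebesgue F \<longleftrightarrow> integrable lborel G"
    using integrable_cong_AE[OF Fm Gl ae'] integrable_completion[OF G'] by simp
qed

lemma ex_borel_version:
  fixes g :: "real^3 \<Rightarrow> real^3"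
  assumes "g \<in> borel_measurable lebesgue"
  obtains h where "h \<in> borel_measurable borel" "AE x in lborel. g x = h x"
proof -
  have "(\<lambda>x. g x \<bullet> axis i 1) \<in> borel_measurable lebesgue" for i
    using assms by (intro borel_measurable_inner) auto
  then have "\<exists>h\<in>borel_measurable lborel. AE x in lborel. g x \<bullet> axis i 1 = h x" for i
    by (rule completion_ex_borel_measurable_real)
  then obtain h where h: "\<And>i. h i \<in> borel_measurable lborel"
      "\<And>i. AE x in lborel. g x \<bullet> axis i 1 = h i x"
    by metis
  show thesis
  proof (rule that[of "\<lambda>x. \<chi> i. h i x"])
    show "(\<lambda>x. \<chi> i. h i x) \<in> borel_measurable borel"
      using h(1) by (subst borel_measurable_euclidean_space) (auto simp: Basis_vec_def inner_axis)
    have "AE x in lborel. \<forall>i. g x \<bullet> axis i 1 = h i x" using h(2) by (simp add: AE_all_countable)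
    then show "AE x in lborel. g x = (\<chi> i. h i x)" by (simp add: vec_eq_iff inner_axis)
  qed
qed

lemma frechet_derivative_test_function_borel:
  "test_function \<psi> \<Longrightarrow> (\<lambda>x. frechet_derivative \<psi> (at x) v) \<in> borel_measurable borel"
  by (rule test_function_borel[OF test_function_frechet_derivative])

lemma AE_mult_cong:
  fixes u v \<psi> :: "'a \<Rightarrow> real"
  shows "AE x in M. u x = v x \<Longrightarrow> AE x in M. u x * \<psi> x = v x * \<psi> x"
  by (auto elim: eventually_mono)

text \<open>The bridge between the given definitions and Borel versions. Square integrability of u
  is stated separately because \<open>is_weak_gradient\<close> demands it of the gradient
  only.\<close>

lemma is_weak_gradient_iff_sobolev_pair:
  assumes "v \<in> borel_measurable borel" "h \<in> borel_measurable borel"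
    and uv: "AE x in lborel. u x = v x" and gh: "AE x in lborel. g x = h x"
  shows "square_integrable u \<and> is_weak_gradient u g \<longleftrightarrow> sobolev_pair v h"
proof -
  note [measurable] = assms(1,2)
  have gm: "g \<in> borel_measurable lebesgue"
  proof (rule borel_measurable_AE)
    show "h \<in> borel_measurable lebesgue" by (rule measurable_completion) simp
    show "AE x in lebesgue. h x = g x" using AE_completion[OF gh] by (rule AE_mp) simp
  qed
  have um: "u \<in> borel_measurable lebesgue"
    by (rule integral_lebesgue_lborel(3)[OF assms(1) uv])
  have 1: "integrable lebesgue (\<lambda>x. (norm (u x))\<^sup>2) \<longleftrightarrow> integrable lborel (\<lambda>x. (v x)\<^sup>2)"
    by (rule integral_lebesgue_lborel(2)) (use uv in \<open>auto elim!: eventually_mono\<close>)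
  have 2: "integrable lebesgue (\<lambda>x. (norm (g x))\<^sup>2) \<longleftrightarrow> integrable lborel (\<lambda>x. (norm (h x))\<^sup>2)"
    by (rule integral_lebesgue_lborel(2)) (use gh in \<open>auto elim!: eventually_mono\<close>)
  have 3: "(\<integral>x. u x * frechet_derivative \<psi> (at x) (axis i 1) \<partial>lebesgue) =
      (\<integral>x. v x * frechet_derivative \<psi> (at x) (axis i 1) \<partial>lborel)" if "test_function \<psi>" for \<psi> i
    by (rule integral_lebesgue_lborel(1)[OF borel_measurable_times AE_mult_cong])
       (use frechet_derivative_test_function_borel[OF that] uv assms(1) in auto)
  have 4: "(\<integral>x. (g x $ i) * \<psi> x \<partial>lebesgue) = (\<integral>x. (h x $ i) * \<psi> x \<partial>lborel)"
    if "test_function \<psi>" for \<psi> i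
  proof (rule integral_lebesgue_lborel(1)[OF borel_measurable_times AE_mult_cong])
    have "h x $ i = h x \<bullet> axis i 1" for x by (simp add: inner_axis)
    then show "(\<lambda>x. h x $ i) \<in> borel_measurable borel" by simp
    show "AE x in lborel. g x $ i = h x $ i" using gh by (rule AE_mp) simp
  qed (rule test_function_borel[OF that])
  show ?thesis
    unfolding square_integrable_def is_weak_gradient_def sobolev_pair_def
    using um gm assms(1,2) 1 2 3 4 by auto
qed

lemma H1_imp_sobolev_pair:
  assumes "u \<in> H1"
  obtains v g where "sobolev_pair v g" "AE x in lborel. u x = v x" "AE x in lborel. weak_gradient u x = g x"
proof -
  have wg: "is_weak_gradient u (weak_gradient u)"
    using assms unfolding weak_gradient_def H1_def by (simp add: someI_ex)
  have sq: "square_integrable u" using assms by (simp add: H1_def)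
  obtain v where v: "v \<in> borel_measurable lborel" "AE x in lborel. u x = v x"
    using completion_ex_borel_measurable_real[of u lborel] sq by (auto simp: square_integrable_def)
  obtain g where g: "g \<in> borel_measurable borel" "AE x in lborel. weak_gradient u x = g x"
    using ex_borel_version[of "weak_gradient u"] wg by (auto simp: is_weak_gradient_def square_integrable_def)
  show thesis
    using is_weak_gradient_iff_sobolev_pair[OF _ g(1) v(2) g(2)] v(1) sq wg
    by (intro that[OF _ v(2) g(2)]) simp
qed

text \<open>\<open>H1_norm\<close> refers to a gradient picked by choice. Almost everywhere
  uniqueness identifies it with g, so the norm can be computed from any pair.\<close>

lemma sobolev_pair_imp_H1:
  assumes sp: "sobolev_pair v g" and uv: "AE x in lborel. u x = v x"
  shows "u \<in> H1" and "(H1_norm u)\<^sup>2 = (\<integral>x. (norm (g x))\<^sup>2 \<partial>lborel) + (\<integral>x. (v x)\<^sup>2 \<partial>lborel)"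
proof -
  note c = sobolev_pair_components[OF sp]
  note [measurable] = c(1,2)
  have "square_integrable u \<and> is_weak_gradient u g"
    using is_weak_gradient_iff_sobolev_pair[OF c(1,2) uv, of g] sp by simp
  then show H1: "u \<in> H1" by (auto simp: H1_def)
  obtain v' g' where sp': "sobolev_pair v' g'" and uv': "AE x in lborel. u x = v' x"
    and wg: "AE x in lborel. weak_gradient u x = g' x"
    using H1_imp_sobolev_pair[OF H1] by blast
  have "sobolev_pair v g'"
    using is_weak_gradient_iff_sobolev_pair[OF c(1) sobolev_pair_components(2)[OF sp'] uv wg]
      is_weak_gradient_iff_sobolev_pair[OF sobolev_pair_components(1,2)[OF sp'] uv' wg] sp' by blast
  then have "AE x in lborel. g' x = g x" by (rule sobolev_pair_unique[OF _ sp])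
  with wg have wg': "AE x in lborel. weak_gradient u x = g x"
    by eventually_elim simp
  have "(\<integral>x. (norm (weak_gradient u x))\<^sup>2 + (u x)\<^sup>2 \<partial>lebesgue) = (\<integral>x. (norm (g x))\<^sup>2 + (v x)\<^sup>2 \<partial>lborel)"
  proof (rule integral_lebesgue_lborel(1))
    show "AE x in lborel. (norm (weak_gradient u x))\<^sup>2 + (u x)\<^sup>2 = (norm (g x))\<^sup>2 + (v x)\<^sup>2"
      using wg' uv by eventually_elim simp
  qed measurable
  also have "\<dots> = (\<integral>x. (norm (g x))\<^sup>2 \<partial>lborel) + (\<integral>x. (v x)\<^sup>2 \<partial>lborel)"
    using c(3,4) by simp
  finally show "(H1_norm u)\<^sup>2 = (\<integral>x. (norm (g x))\<^sup>2 \<partial>lborel) + (\<integral>x. (v x)\<^sup>2 \<partial>lborel)"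
    unfolding H1_norm_def by (simp add: integral_nonneg_AE)
qed

lemma H1_norm_nonneg: "0 \<le> H1_norm u"
  unfolding H1_norm_def by (simp add: integral_nonneg_AE)

lemma sobolev_pair_scale:
  assumes "sobolev_pair v g"
  shows "sobolev_pair (\<lambda>x. c * v x) (\<lambda>x. c *\<^sub>R g x)"
  using assms unfolding sobolev_pair_def by (auto simp: power_mult_distrib mult.assoc)

lemma H1_scale:
  assumes "u \<in> H1"
  shows "(\<lambda>x. c * u x) \<in> H1" and "H1_norm (\<lambda>x. c * u x) = \<bar>c\<bar> * H1_norm u"
proof -
  obtain v g where sp: "sobolev_pair v g" and uv: "AE x in lborel. u x = v x"
    using H1_imp_sobolev_pair[OF assms] by blast
  have cuv: "AE x in lborel. c * u x = c * v x" using uv by (rule AE_mp) simp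
  note s = sobolev_pair_imp_H1[OF sobolev_pair_scale[OF sp, of c] cuv]
  show "(\<lambda>x. c * u x) \<in> H1" by (rule s(1))
  have "(H1_norm (\<lambda>x. c * u x))\<^sup>2 = (\<bar>c\<bar> * H1_norm u)\<^sup>2"
    unfolding s(2) power_mult_distrib sobolev_pair_imp_H1(2)[OF sp uv]
    by (simp add: power_mult_distrib distrib_left)
  then show "H1_norm (\<lambda>x. c * u x) = \<bar>c\<bar> * H1_norm u"
    by (rule power2_eq_imp_eq) (simp_all add: H1_norm_nonneg)
qed

lemma zero_in_H1: "(\<lambda>_. 0) \<in> H1" and H1_norm_zero: "H1_norm (\<lambda>_. 0) = 0"
proof -
  have "sobolev_pair (\<lambda>_. 0) (\<lambda>_. 0)" by (simp add: sobolev_pair_def)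
  from sobolev_pair_imp_H1[OF this, of "\<lambda>_. 0"]
  show "(\<lambda>_. 0) \<in> H1" "H1_norm (\<lambda>_. 0) = 0" by simp_all
qed

subsection \<open>Coulomb energy\<close>

text \<open>Instantiated both with the weight of the equation and with the constant weight 1, since
  the energies of the two are compared. The bound S inside is common to function and gradient; the
  squared H1 norm is the typical choice.\<close>

locale coulomb_weight =
  fixes \<rho> :: "real^3 \<Rightarrow> real" and K :: real
  assumes weight_borel [measurable]: "\<rho> \<in> borel_measurable borel"
    and weight_pos: "\<And>x. 0 < \<rho> x" and weight_le: "\<And>x. \<rho> x \<le> K"
begin

lemma bound_pos: "0 < K"
  using weight_pos weight_le by (rule less_le_trans)

context
  fixes v :: "real^3 \<Rightarrow> real" and g :: "real^3 \<Rightarrow> real^3" and S :: real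
  assumes sp: "sobolev_pair v g"
    and Sv: "(\<integral>x. (v x)\<^sup>2 \<partial>lborel) \<le> S" and Sg: "(\<integral>x. (norm (g x))\<^sup>2 \<partial>lborel) \<le> S"
begin

lemma pair_borel [measurable]: "v \<in> borel_measurable borel"
  using sobolev_pair_components(1)[OF sp] .

lemma S_nonneg: "0 \<le> S"
  using Sv by (rule order.trans[rotated]) simp

lemma nn_integral_potential_le:
  "(\<integral>\<^sup>+y. ennreal (\<rho> y * (v y)\<^sup>2 / norm (x - y)) \<partial>lborel) \<le> ennreal (K * (257 * S))"
proof -
  have "(\<integral>\<^sup>+y. ennreal (\<rho> y * (v y)\<^sup>2 / norm (x - y)) \<partial>lborel)
      \<le> (\<integral>\<^sup>+y. ennreal K * ennreal ((v y)\<^sup>2 / norm (x - y)) \<partial>lborel)"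
    using weight_le bound_pos
    by (intro nn_integral_mono)
       (auto simp: ennreal_mult'[symmetric] intro!: ennreal_leI divide_right_mono mult_right_mono)
  also have "\<dots> = ennreal K * (\<integral>\<^sup>+y. ennreal ((v y)\<^sup>2 / norm (x - y)) \<partial>lborel)"
    by (rule nn_integral_cmult) measurable
  also have "\<dots> \<le> ennreal K * ennreal (257 * S)"
    by (intro mult_left_mono nn_integral_coulomb_le[OF sp Sv Sg]) simp
  finally show ?thesis using bound_pos by (simp add: ennreal_mult'[symmetric])
qed

lemma integrable_potential: "integrable lborel (\<lambda>y. \<rho> y * (v y)\<^sup>2 / norm (x - y))"
  using nn_integral_potential_le[of x] weight_pos
  by (intro integrableI_nonneg) (auto simp: less_imp_le top_unique le_less_trans)

lemma potential_le: "(\<integral>y. \<rho> y * (v y)\<^sup>2 / norm (x - y) \<partial>lborel) \<le> K * (257 * S)"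
proof -
  have "ennreal (\<integral>y. \<rho> y * (v y)\<^sup>2 / norm (x - y) \<partial>lborel) \<le> ennreal (K * (257 * S))"
    using nn_integral_potential_le[of x] weight_pos
    by (subst nn_integral_eq_integral[symmetric, OF integrable_potential]) (auto simp: less_imp_le)
  then show ?thesis using bound_pos S_nonneg by (simp add: ennreal_le_iff)
qed

lemma phi_eq: "phi \<rho> v x = 1 / (4 * pi) * (\<integral>y. \<rho> y * (v y)\<^sup>2 / norm (x - y) \<partial>lborel)"
  unfolding phi_def by (subst integral_lebesgue_lborel(1)) auto

lemma phi_nonneg: "0 \<le> phi \<rho> v x"
  unfolding phi_eq using weight_pos by (intro mult_nonneg_nonneg integral_nonneg_AE) (auto simp: less_imp_le)

lemma phi_le: "phi \<rho> v x \<le> 257 * K * S"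
proof -
  have "1 / (4 * pi) * (\<integral>y. \<rho> y * (v y)\<^sup>2 / norm (x - y) \<partial>lborel) \<le> 1 * (K * (257 * S))"
    using potential_le[of x] pi_gt3 weight_pos
    by (intro mult_mono integral_nonneg_AE) (auto simp: less_imp_le)
  then show ?thesis by (simp add: phi_eq)
qed

lemma phi_borel [measurable]: "phi \<rho> v \<in> borel_measurable borel"
proof -
  have "(\<lambda>x. 1 / (4 * pi) * (\<integral>y. \<rho> y * (v y)\<^sup>2 / norm (x - y) \<partial>lborel)) \<in> borel_measurable borel"
    by measurable
  then show ?thesis by (simp add: phi_eq[abs_def])
qed

text \<open>The potential is bounded by 257 K S and the outer weight by K, which leaves the integral
  of v^2, at most S.\<close>

lemma integrable_energy: "integrable lborel (\<lambda>x. \<rho> x * phi \<rho> v x * (v x)\<^sup>2)"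
  and energy_le: "(\<integral>x. \<rho> x * phi \<rho> v x * (v x)\<^sup>2 \<partial>lborel) \<le> 257 * K\<^sup>2 * S\<^sup>2"
proof -
  have b: "\<rho> x * phi \<rho> v x * (v x)\<^sup>2 \<le> K * (257 * K * S) * (v x)\<^sup>2" for x
    using weight_le phi_le phi_nonneg bound_pos by (intro mult_right_mono mult_mono) auto
  have int: "integrable lborel (\<lambda>x. K * (257 * K * S) * (v x)\<^sup>2)"
    using sobolev_pair_components(3)[OF sp] by simp
  show 1: "integrable lborel (\<lambda>x. \<rho> x * phi \<rho> v x * (v x)\<^sup>2)"
    by (rule Bochner_Integration.integrable_bound[OF int])
       (use b weight_pos phi_nonneg bound_pos S_nonneg in \<open>auto simp: less_imp_le abs_mult\<close>)
  have "(\<integral>x. \<rho> x * phi \<rho> v x * (v x)\<^sup>2 \<partial>lborel) \<le> (\<integral>x. K * (257 * K * S) * (v x)\<^sup>2 \<partial>lborel)"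
    by (rule integral_mono[OF 1 int b])
  also have "\<dots> \<le> K * (257 * K * S) * S"
    using Sv bound_pos S_nonneg by (simp add: mult_left_mono)
  finally show "(\<integral>x. \<rho> x * phi \<rho> v x * (v x)\<^sup>2 \<partial>lborel) \<le> 257 * K\<^sup>2 * S\<^sup>2"
    by (simp add: power2_eq_square mult_ac)
qed

lemma energy_nonneg: "0 \<le> (\<integral>x. \<rho> x * phi \<rho> v x * (v x)\<^sup>2 \<partial>lborel)"
  using weight_pos phi_nonneg by (intro integral_nonneg_AE) (auto simp: less_imp_le)

text \<open>The kernel is positive, so the potential vanishing at a single point already forces v =
  0 almost everywhere; if it vanishes nowhere, the factor v^2 of the energy density must.\<close>

lemma energy_eq_0D:
  assumes "(\<integral>x. \<rho> x * phi \<rho> v x * (v x)\<^sup>2 \<partial>lborel) = 0"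
  shows "AE x in lborel. v x = 0"
proof -
  have "AE x in lborel. \<rho> x * phi \<rho> v x * (v x)\<^sup>2 = 0"
    using assms weight_pos phi_nonneg
    by (subst (asm) integral_nonneg_eq_0_iff_AE[OF integrable_energy]) (auto simp: less_imp_le)
  then have ae: "AE x in lborel. phi \<rho> v x = 0 \<or> v x = 0"
    using weight_pos by (auto simp: less_le elim!: eventually_mono)
  show ?thesis
  proof (cases "\<exists>x. phi \<rho> v x = 0")
    case True
    then obtain x where "phi \<rho> v x = 0" by blast
    then have "(\<integral>y. \<rho> y * (v y)\<^sup>2 / norm (x - y) \<partial>lborel) = 0" by (simp add: phi_eq)
    then have "AE y in lborel. \<rho> y * (v y)\<^sup>2 / norm (x - y) = 0"
      using weight_pos
      by (subst (asm) integral_nonneg_eq_0_iff_AE[OF integrable_potential]) (auto simp: less_imp_le)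
    \<comment> \<open>At y = x the quotient is 0 by the convention for division by zero and says
      nothing about v; a single point is a null set.\<close>
    moreover have "AE y in lborel. y \<noteq> x" by (rule AE_lborel_singleton)
    ultimately show ?thesis
    proof eventually_elim
      case (elim y)
      then show ?case using weight_pos[of y] by auto
    qed
  next
    case False
    then show ?thesis using ae by (auto elim: eventually_mono)
  qed
qed

text \<open>The weight enters once inside the potential and once outside, hence the square of
  m.\<close>

lemma energy_ge:
  assumes "0 \<le> m" "\<And>x. m \<le> \<rho> x"
  shows "m\<^sup>2 * (\<integral>x. phi (\<lambda>_. 1) v x * (v x)\<^sup>2 \<partial>lborel) \<le> (\<integral>x. \<rho> x * phi \<rho> v x * (v x)\<^sup>2 \<partial>lborel)"
proof -
  interpret one: coulomb_weight "\<lambda>_. 1" 1 by unfold_locales auto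
  note o_phi = one.phi_eq[OF sp Sv Sg] and o_pot = one.integrable_potential[OF sp Sv Sg]
  have o_int: "integrable lborel (\<lambda>x. phi (\<lambda>_. 1) v x * (v x)\<^sup>2)"
    using one.integrable_energy[OF sp Sv Sg] by simp
  have phi: "m * phi (\<lambda>_. 1) v x \<le> phi \<rho> v x" for x
  proof -
    have "(\<integral>y. m * (1 * (v y)\<^sup>2 / norm (x - y)) \<partial>lborel) \<le> (\<integral>y. \<rho> y * (v y)\<^sup>2 / norm (x - y) \<partial>lborel)"
      using assms(2)
      by (intro integral_mono integrable_mult_right o_pot integrable_potential)
         (auto intro!: divide_right_mono mult_right_mono)
    then have "m * (\<integral>y. 1 * (v y)\<^sup>2 / norm (x - y) \<partial>lborel) \<le> (\<integral>y. \<rho> y * (v y)\<^sup>2 / norm (x - y) \<partial>lborel)"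
      by (simp only: integral_mult_right_zero)
    then show ?thesis unfolding o_phi phi_eq
      by (simp add: divide_right_mono)
  qed
  have "m * (m * phi (\<lambda>_. 1) v x) * (v x)\<^sup>2 \<le> \<rho> x * phi \<rho> v x * (v x)\<^sup>2" for x
    using assms phi one.phi_nonneg[OF sp Sv Sg] weight_pos[of x]
    by (intro mult_right_mono mult_mono) auto
  then have "(\<integral>x. m\<^sup>2 * (phi (\<lambda>_. 1) v x * (v x)\<^sup>2) \<partial>lborel) \<le> (\<integral>x. \<rho> x * phi \<rho> v x * (v x)\<^sup>2 \<partial>lborel)"
    by (intro integral_mono integrable_mult_right o_int integrable_energy)
       (simp add: power2_eq_square mult_ac)
  then show ?thesis by simp
qed

end

lemma lebesgue_energy_eq:
  assumes [measurable]: "v \<in> borel_measurable borel" and sp: "sobolev_pair v g" and uv: "AE x in lborel. u x = v x"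
  shows "phi \<rho> u = phi \<rho> v"
    and "(\<integral>x. \<rho> x * phi \<rho> u x * (u x)\<^sup>2 \<partial>lebesgue) = (\<integral>x. \<rho> x * phi \<rho> v x * (v x)\<^sup>2 \<partial>lborel)"
proof -
  show eq: "phi \<rho> u = phi \<rho> v"
  proof
    fix x
    have "AE y in lborel. \<rho> y * (u y)\<^sup>2 / norm (x - y) = \<rho> y * (v y)\<^sup>2 / norm (x - y)"
      using uv by (auto elim: eventually_mono)
    then have "(\<integral>y. \<rho> y * (u y)\<^sup>2 / norm (x - y) \<partial>lebesgue) = (\<integral>y. \<rho> y * (v y)\<^sup>2 / norm (x - y) \<partial>lborel)"
      by (intro integral_lebesgue_lborel(1)) auto
    also have "\<dots> = (\<integral>y. \<rho> y * (v y)\<^sup>2 / norm (x - y) \<partial>lebesgue)"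
      by (rule integral_lebesgue_lborel(1)[symmetric]) auto
    finally show "phi \<rho> u x = phi \<rho> v x" by (simp add: phi_def)
  qed
  define S where "S = (\<integral>x. (v x)\<^sup>2 \<partial>lborel) + (\<integral>x. (norm (g x))\<^sup>2 \<partial>lborel)"
  have [measurable]: "phi \<rho> v \<in> borel_measurable borel"
    by (rule phi_borel[OF sp, of S]) (simp_all add: S_def)
  show "(\<integral>x. \<rho> x * phi \<rho> u x * (u x)\<^sup>2 \<partial>lebesgue) = (\<integral>x. \<rho> x * phi \<rho> v x * (v x)\<^sup>2 \<partial>lborel)"
    unfolding eq by (rule integral_lebesgue_lborel(1)) (use uv in \<open>auto elim: eventually_mono\<close>)
qed

end

lemma phi_scale: "phi \<rho> (\<lambda>x. c * u x) x = c\<^sup>2 * phi \<rho> u x"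
proof -
  have "(\<lambda>y. \<rho> y * (c * u y)\<^sup>2 / norm (x - y)) = (\<lambda>y. c\<^sup>2 * (\<rho> y * (u y)\<^sup>2 / norm (x - y)))"
    by (simp add: power_mult_distrib mult_ac)
  then show ?thesis unfolding phi_def by (simp only: integral_mult_right_zero mult.left_commute)
qed

subsection \<open>The nonlinearity\<close>

text \<open>Near 0 the quotient f(s)/s is small, for large s the exponent q - 1 is below 2, and in
  between f is bounded by compactness while s stays away from 0.\<close>

lemma nonlinearity_growth:
  assumes "F1 f" "F2 f"
  obtains C where "0 \<le> C" "\<And>s. \<bar>f s\<bar> \<le> C * (\<bar>s\<bar> + s\<^sup>2)"
proof -
  have cont: "continuous_on A f" for A
    using assms(1) continuous_on_subset by (auto simp: F1_def)
  have neg: "f s = 0" if "s < 0" for s using assms(1) that by (simp add: F1_def)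
  \<comment> \<open>The bound forces this value; continuity yields it from the vanishing of f on the
    negative axis.\<close>
  have zero: "f 0 = 0"
  proof (rule tendsto_unique[of "at_left 0" f])
    show "(f \<longlongrightarrow> f 0) (at_left 0)"
      using cont[of UNIV] by (auto simp: continuous_on_def intro: tendsto_within_subset)
    show "(f \<longlongrightarrow> 0) (at_left 0)"
      by (rule Lim_transform_eventually[OF tendsto_const])
         (use neg in \<open>auto intro: eventually_at_leftI[of "-1"]\<close>)
  qed simp
  obtain d where d: "0 < d" "\<And>s. 0 < s \<Longrightarrow> s < d \<Longrightarrow> \<bar>f s / s\<bar> < 1"
  proof -
    have "\<forall>\<^sub>F s in at_right 0. dist (f s / s) 0 < 1"
      using assms(1) unfolding F1_def by (intro tendstoD) auto
    then show thesis
      by (auto simp: eventually_at_right_field dist_real_def intro: that)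
  qed
  obtain q a where q: "2 \<le> q" "q < 3" "((\<lambda>s. f s / s powr (q - 1)) \<longlongrightarrow> a) at_top"
    using assms(2) by (auto simp: F2_def)
  obtain m where m: "1 \<le> m" "\<And>s. m \<le> s \<Longrightarrow> \<bar>f s / s powr (q - 1) - a\<bar> < 1"
  proof -
    have "\<forall>\<^sub>F s in at_top. dist (f s / s powr (q - 1)) a < 1"
      using q(3) by (rule tendstoD) simp
    then obtain m0 where "\<And>s. m0 \<le> s \<Longrightarrow> \<bar>f s / s powr (q - 1) - a\<bar> < 1"
      by (auto simp: eventually_at_top_linorder dist_real_def)
    \<comment> \<open>The threshold is at least 1, so that beyond it powers of s increase with the
      exponent.\<close>
    then show thesis by (intro that[of "max 1 m0"]) auto
  qed
  have "bounded (f ` {0..m})"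
    by (intro compact_imp_bounded compact_continuous_image cont) auto
  then obtain B where B: "\<And>s. 0 \<le> s \<Longrightarrow> s \<le> m \<Longrightarrow> \<bar>f s\<bar> \<le> B"
    unfolding bounded_iff by (metis atLeastAtMost_iff imageI real_norm_def)
  have B0: "0 \<le> B" using B[of 0] m(1) by auto
  \<comment> \<open>One constant for the three ranges: 1 near 0, B / d in the middle (as B = (B / d)
    d and d \<le> s), and 1 + |a| at infinity.\<close>
  define C where "C = 1 + \<bar>a\<bar> + B / d"
  have C: "1 + \<bar>a\<bar> \<le> C" "B / d \<le> C" "1 \<le> C" using B0 d(1) by (auto simp: C_def)
  have pos: "\<bar>f s\<bar> \<le> C * s \<or> \<bar>f s\<bar> \<le> C * s\<^sup>2" if "0 < s" for s
  proof -
    consider "s < d" | "d \<le> s" "s \<le> m" | "m \<le> s" by linarith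
    then show ?thesis
    proof cases
      case 1
      then have "\<bar>f s\<bar> \<le> 1 * s" using d(2)[OF that] that by (simp add: field_simps)
      also have "\<dots> \<le> C * s" using C that by (intro mult_right_mono) auto
      finally show ?thesis by simp
    next
      case 2
      have "\<bar>f s\<bar> \<le> B / d * d" using B[of s] 2 d(1) by simp
      also have "\<dots> \<le> C * s" using C 2 B0 d(1) by (intro mult_mono) auto
      finally show ?thesis by simp
    next
      case 3
      then have s1: "1 \<le> s" using m(1) by simp
      have p: "0 < s powr (q - 1)" using that by simp
      have "\<bar>f s / s powr (q - 1)\<bar> \<le> C" using m(2)[OF 3] C by linarith
      then have "\<bar>f s\<bar> \<le> C * s powr (q - 1)" using p by (simp add: abs_div field_simps)
      also have "\<dots> \<le> C * s powr 2" using C s1 q by (intro mult_left_mono powr_mono) auto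
      also have "s powr 2 = s\<^sup>2" using that by (simp add: powr_numeral)
      finally show ?thesis by simp
    qed
  qed
  have "\<bar>f s\<bar> \<le> C * (\<bar>s\<bar> + s\<^sup>2)" for s
  proof -
    have nn: "0 \<le> C * \<bar>s\<bar>" "0 \<le> C * s\<^sup>2" using C by auto
    consider "s < 0" | "s = 0" | "0 < s" by linarith
    then show ?thesis
    proof cases
      case 1
      have "0 \<le> C * (\<bar>s\<bar> + s\<^sup>2)" using C by simp
      then show ?thesis using neg[OF 1] by simp
    next
      case 2
      then show ?thesis using zero by simp
    next
      case 3
      then show ?thesis using pos[of s] nn by (auto simp: distrib_left)
    qed
  qed
  then show thesis using C by (intro that[of C]) auto
qed

lemma primitive_has_derivative:
  assumes "continuous_on UNIV f"
  shows "(primitive f has_real_derivative f t) (at t)"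
proof -
  \<comment> \<open>The interval contains the base point 0 and has t in its interior, whatever the
    sign of t.\<close>
  let ?b = "\<bar>t\<bar> + 1"
  have "continuous_on {-?b..?b} f" using assms continuous_on_subset by blast
  then have "((\<lambda>u. LBINT y=ereal 0..ereal u. f y) has_vector_derivative f t) (at t within {-?b..?b})"
    by (intro interval_integral_FTC2) auto
  then have "(primitive f has_vector_derivative f t) (at t within {-?b..?b})"
    by (simp only: primitive_def[abs_def] zero_ereal_def)
  then show ?thesis
    by (simp add: has_real_derivative_iff_has_vector_derivative at_within_Icc_at)
qed

lemma primitive_0: "primitive f 0 = 0"
  by (simp add: primitive_def zero_ereal_def[symmetric])

lemma primitive_diff_le:
  assumes f: "continuous_on UNIV f" and C: "0 \<le> C" "\<And>s. \<bar>f s\<bar> \<le> C * (\<bar>s\<bar> + s\<^sup>2)"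
    and R: "\<bar>s\<bar> \<le> R" "\<bar>t\<bar> \<le> R"
  shows "\<bar>primitive f s - primitive f t\<bar> \<le> C * (R + R\<^sup>2) * \<bar>s - t\<bar>"
proof -
  have "norm (primitive f s - primitive f t) \<le> C * (R + R\<^sup>2) * norm (s - t)"
  proof (rule field_differentiable_bound[of "{-R..R}"])
    fix z assume z: "z \<in> {-R..R}"
    show "(primitive f has_field_derivative f z) (at z within {-R..R})"
      using primitive_has_derivative[OF f] by (rule has_field_derivative_at_within)
    have "\<bar>z\<bar> \<le> R" using z by auto
    then have "\<bar>z\<bar> + z\<^sup>2 \<le> R + R\<^sup>2"
      using power_mono[of "\<bar>z\<bar>" R 2] by simp
    then show "norm (f z) \<le> C * (R + R\<^sup>2)"
      using C(2)[of z] mult_left_mono[OF _ C(1)] by (metis order.trans real_norm_def)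
  qed (use R in auto)
  then show ?thesis by simp
qed

subsection \<open>The energy functional\<close>

text \<open>The parameter c serves two purposes: c = 1 gives the linear bound 65 S when S \<le> 1,
  and c = 1 + S gives finiteness for every S.\<close>

lemma sobolev_pair_cube:
  assumes sp: "sobolev_pair v g"
    and Sv: "(\<integral>x. (v x)\<^sup>2 \<partial>lborel) \<le> S" and Sg: "(\<integral>x. (norm (g x))\<^sup>2 \<partial>lborel) \<le> S"
    and c: "1 \<le> c" "S \<le> c ^ 3"
  shows "integrable lborel (\<lambda>x. \<bar>v x\<bar> ^ 3)"
    and "(\<integral>x. \<bar>v x\<bar> ^ 3 \<partial>lborel) \<le> (1 + 64 * c\<^sup>2) * S"
proof -
  note [measurable] = sobolev_pair_components(1)[OF sp]
  note le = nn_integral_cube_le[OF sp Sv Sg c]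
  show int: "integrable lborel (\<lambda>x. \<bar>v x\<bar> ^ 3)"
    using le by (intro integrableI_nonneg) (auto simp: top_unique le_less_trans)
  have "0 \<le> S" using Sv by (rule order.trans[rotated]) simp
  moreover have "ennreal (\<integral>x. \<bar>v x\<bar> ^ 3 \<partial>lborel) \<le> ennreal ((1 + 64 * c\<^sup>2) * S)"
    using le by (subst nn_integral_eq_integral[symmetric, OF int]) auto
  ultimately show "(\<integral>x. \<bar>v x\<bar> ^ 3 \<partial>lborel) \<le> (1 + 64 * c\<^sup>2) * S"
    by (simp add: ennreal_le_iff)
qed

lemma H1_obtain_pair:
  assumes "u \<in> H1"
  obtains v g where "sobolev_pair v g" "AE x in lborel. u x = v x"
    "(\<integral>x. (v x)\<^sup>2 \<partial>lborel) \<le> (H1_norm u)\<^sup>2" "(\<integral>x. (norm (g x))\<^sup>2 \<partial>lborel) \<le> (H1_norm u)\<^sup>2"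
proof -
  obtain v g where sp: "sobolev_pair v g" and uv: "AE x in lborel. u x = v x"
    using H1_imp_sobolev_pair[OF assms] by blast
  have "0 \<le> (\<integral>x. (v x)\<^sup>2 \<partial>lborel)" "0 \<le> (\<integral>x. (norm (g x))\<^sup>2 \<partial>lborel)" by simp_all
  with sobolev_pair_imp_H1(2)[OF sp uv] show thesis by (intro that[OF sp uv]) linarith+
qed

locale schroedinger_poisson = coulomb_weight \<rho> K for \<rho> K +
  fixes f :: "real \<Rightarrow> real" and C :: real
  assumes f_cont: "continuous_on UNIV f"
    and C_nonneg: "0 \<le> C" and growth: "\<And>s. \<bar>f s\<bar> \<le> C * (\<bar>s\<bar> + s\<^sup>2)"
begin

lemma f_borel [measurable]: "f \<in> borel_measurable borel"
  using f_cont by (rule borel_measurable_continuous_onI)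

lemma primitive_borel [measurable]: "primitive f \<in> borel_measurable borel"
  using primitive_has_derivative[OF f_cont]
  by (intro borel_measurable_continuous_onI DERIV_continuous_on) (auto intro: has_field_derivative_at_within)

lemma primitive_le: "\<bar>primitive f t\<bar> \<le> C * (t\<^sup>2 + \<bar>t\<bar> ^ 3)"
proof -
  have "\<bar>primitive f t\<bar> \<le> C * (\<bar>t\<bar> + \<bar>t\<bar>\<^sup>2) * \<bar>t\<bar>"
    using primitive_diff_le[OF f_cont C_nonneg growth, of t "\<bar>t\<bar>" 0] by (simp add: primitive_0)
  also have "\<dots> = C * (t\<^sup>2 + \<bar>t\<bar> ^ 3)"
    by (simp add: power2_eq_square power3_eq_cube algebra_simps)
  finally show ?thesis .
qed

lemma integrable_square_cube:
  assumes sp: "sobolev_pair v g"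
  shows "integrable lborel (\<lambda>x. (v x)\<^sup>2 + \<bar>v x\<bar> ^ 3)"
proof -
  define S where "S = (\<integral>x. (v x)\<^sup>2 \<partial>lborel) + (\<integral>x. (norm (g x))\<^sup>2 \<partial>lborel)"
  have S: "0 \<le> S" "(\<integral>x. (v x)\<^sup>2 \<partial>lborel) \<le> S" "(\<integral>x. (norm (g x))\<^sup>2 \<partial>lborel) \<le> S"
    by (simp_all add: S_def)
  have "S \<le> (1 + S) ^ 1" by simp
  also have "\<dots> \<le> (1 + S) ^ 3" using S(1) by (intro power_increasing) auto
  finally have "integrable lborel (\<lambda>x. \<bar>v x\<bar> ^ 3)"
    using sobolev_pair_cube(1)[OF sp S(2,3), of "1 + S"] S(1) by simp
  then show ?thesis using sobolev_pair_components(3)[OF sp] by simp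
qed

lemma integrable_primitive:
  assumes sp: "sobolev_pair v g"
  shows "integrable lborel (\<lambda>x. primitive f (v x))"
proof (rule Bochner_Integration.integrable_bound)
  note [measurable] = sobolev_pair_components(1)[OF sp]
  show "integrable lborel (\<lambda>x. C * ((v x)\<^sup>2 + \<bar>v x\<bar> ^ 3))"
    using integrable_square_cube[OF sp] by (rule integrable_mult_right)
  show "AE x in lborel. norm (primitive f (v x)) \<le> norm (C * ((v x)\<^sup>2 + \<bar>v x\<bar> ^ 3))"
    using primitive_le C_nonneg by (intro AE_I2) (auto simp: abs_of_nonneg)
  show "(\<lambda>x. primitive f (v x)) \<in> borel_measurable lborel" by measurable
qed

lemma J_eq:
  assumes sp: "sobolev_pair v g" and uv: "AE x in lborel. u x = v x"
  shows "J f \<rho> u = 1/2 * (H1_norm u)\<^sup>2 + 1/4 * (\<integral>x. \<rho> x * phi \<rho> v x * (v x)\<^sup>2 \<partial>lborel)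
    - (\<integral>x. primitive f (v x) \<partial>lborel)"
proof -
  note [measurable] = sobolev_pair_components(1)[OF sp]
  have "(\<integral>x. primitive f (u x) \<partial>lebesgue) = (\<integral>x. primitive f (v x) \<partial>lborel)"
    by (rule integral_lebesgue_lborel(1)) (use uv in \<open>auto elim: eventually_mono\<close>)
  then show ?thesis
    unfolding J_def lebesgue_energy_eq(2)[OF sobolev_pair_components(1)[OF sp] sp uv] by simp
qed

text \<open>For norm at most 1 the quartic Coulomb bound is at most quadratic, and the cubic
  integral is bounded by 65 times the squared norm; adding the square term gives 66.\<close>

lemma J_small:
  assumes "h \<in> H1" "H1_norm h \<le> 1"
  shows "\<bar>J f \<rho> h\<bar> \<le> (1/2 + 257/4 * K\<^sup>2 + 66 * C) * (H1_norm h)\<^sup>2"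
proof -
  let ?S = "(H1_norm h)\<^sup>2"
  obtain v g where sp: "sobolev_pair v g" and uv: "AE x in lborel. h x = v x"
    and Sv: "(\<integral>x. (v x)\<^sup>2 \<partial>lborel) \<le> ?S" and Sg: "(\<integral>x. (norm (g x))\<^sup>2 \<partial>lborel) \<le> ?S"
    using H1_obtain_pair[OF assms(1)] by blast
  have S1: "?S \<le> 1" using assms(2) H1_norm_nonneg by (simp add: power_le_one)
  let ?A = "\<integral>x. \<rho> x * phi \<rho> v x * (v x)\<^sup>2 \<partial>lborel"
  have A: "0 \<le> ?A" "?A \<le> 257 * K\<^sup>2 * ?S"
  proof -
    show "0 \<le> ?A" by (rule energy_nonneg[OF sp Sv Sg])
    have "?S\<^sup>2 \<le> ?S" unfolding power2_eq_square[of ?S] by (rule mult_left_le[OF S1]) simp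
    then have "257 * K\<^sup>2 * ?S\<^sup>2 \<le> 257 * K\<^sup>2 * ?S" by (intro mult_left_mono) auto
    with energy_le[OF sp Sv Sg] show "?A \<le> 257 * K\<^sup>2 * ?S" by linarith
  qed
  have "\<bar>\<integral>x. primitive f (v x) \<partial>lborel\<bar> \<le> (\<integral>x. \<bar>primitive f (v x)\<bar> \<partial>lborel)"
    by (rule integral_abs_bound)
  also have "\<dots> \<le> (\<integral>x. C * ((v x)\<^sup>2 + \<bar>v x\<bar> ^ 3) \<partial>lborel)"
    by (intro integral_mono integrable_abs integrable_primitive[OF sp] integrable_mult_right
        integrable_square_cube[OF sp] primitive_le)
  also have "\<dots> = C * ((\<integral>x. (v x)\<^sup>2 \<partial>lborel) + (\<integral>x. \<bar>v x\<bar> ^ 3 \<partial>lborel))"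
    using sobolev_pair_components(3)[OF sp] sobolev_pair_cube(1)[OF sp Sv Sg, of 1] S1 by simp
  also have "\<dots> \<le> C * (?S + 65 * ?S)"
    using Sv sobolev_pair_cube(2)[OF sp Sv Sg, of 1] S1 by (intro mult_left_mono add_mono C_nonneg) auto
  finally have "\<bar>\<integral>x. primitive f (v x) \<partial>lborel\<bar> \<le> 66 * C * ?S" by (simp add: algebra_simps)
  then have "\<bar>J f \<rho> h\<bar> \<le> 1/2 * ?S + 1/4 * (257 * K\<^sup>2 * ?S) + 66 * C * ?S"
    unfolding J_eq[OF sp uv] using A zero_le_power2[of "H1_norm h"] by linarith
  then show ?thesis by (simp add: algebra_simps)
qed

text \<open>J vanishes at 0 and is bounded by a multiple of the squared norm nearby, so its
  derivative there is the zero functional.\<close>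

lemma solution_zero: "solution f \<rho> (\<lambda>_. 0)"
proof -
  define M where "M = 1/2 + 257/4 * K\<^sup>2 + 66 * C"
  have M: "0 < M" using C_nonneg by (simp add: M_def add_pos_nonneg)
  have J0: "J f \<rho> (\<lambda>_. 0) = 0"
    using J_small[OF zero_in_H1] by (simp add: H1_norm_zero)
  have "\<exists>\<delta>>0. \<forall>h\<in>H1. H1_norm h < \<delta> \<longrightarrow> \<bar>J f \<rho> h\<bar> \<le> \<epsilon> * H1_norm h" if "0 < \<epsilon>" for \<epsilon>
  proof (intro exI[of _ "min 1 (\<epsilon> / M)"] conjI ballI impI)
    show "0 < min 1 (\<epsilon> / M)" using that M by simp
    fix h assume h: "h \<in> H1" "H1_norm h < min 1 (\<epsilon> / M)"
    have "\<bar>J f \<rho> h\<bar> \<le> M * (H1_norm h)\<^sup>2"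
      unfolding M_def using J_small[OF h(1)] h(2) by simp
    also have "\<dots> = M * H1_norm h * H1_norm h" by (simp add: power2_eq_square)
    also have "\<dots> \<le> \<epsilon> * H1_norm h"
      using h(2) M by (intro mult_right_mono H1_norm_nonneg) (simp add: field_simps)
    finally show "\<bar>J f \<rho> h\<bar> \<le> \<epsilon> * H1_norm h" .
  qed
  moreover have "\<exists>D. \<forall>v\<in>H1. \<bar>0\<bar> \<le> D * H1_norm v" by (intro exI[of _ 0]) simp
  ultimately show ?thesis
    unfolding solution_def critical_point_def has_H1_derivative_def
    using zero_in_H1 J0 by simp
qed

text \<open>Differentiating \<open>J\<close> along the ray \<open>t \<mapsto> (1 + t) u\<close> only involves integrals of \<open>u\<close>
  itself, so the full derivative of \<open>J\<close> is not needed.\<close>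

lemma nehari_identity:
  assumes sol: "solution f \<rho> u" and sp: "sobolev_pair v g" and uv: "AE x in lborel. u x = v x"
  shows "(\<integral>x. f (v x) * v x \<partial>lborel) = (H1_norm u)\<^sup>2 + (\<integral>x. \<rho> x * phi \<rho> v x * (v x)\<^sup>2 \<partial>lborel)"
proof -
  note [measurable] = sobolev_pair_components(1)[OF sp]
  let ?N = "H1_norm u" and ?A = "\<integral>x. \<rho> x * phi \<rho> v x * (v x)\<^sup>2 \<partial>lborel"
    and ?I = "\<integral>x. f (v x) * v x \<partial>lborel"
  have uH: "u \<in> H1" using sol by (simp add: solution_def critical_point_def)
  have J_ray: "J f \<rho> (\<lambda>x. c * u x) = 1/2 * c\<^sup>2 * ?N\<^sup>2 + 1/4 * c ^ 4 * ?A - (\<integral>x. primitive f (c * v x) \<partial>lborel)" for c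
  proof -
    have "AE x in lborel. c * u x = c * v x" using uv by (auto elim: eventually_mono)
    note J_eq[OF sobolev_pair_scale[OF sp] this]
    moreover have "(\<integral>x. \<rho> x * phi \<rho> (\<lambda>x. c * v x) x * (c * v x)\<^sup>2 \<partial>lborel) = c ^ 4 * ?A"
    proof -
      have "\<rho> x * phi \<rho> (\<lambda>x. c * v x) x * (c * v x)\<^sup>2 = c ^ 4 * (\<rho> x * phi \<rho> v x * (v x)\<^sup>2)" for x
        by (simp add: phi_scale power_mult_distrib power4_eq_xxxx power2_eq_square)
      then show ?thesis by (simp only: integral_mult_right_zero)
    qed
    ultimately show ?thesis using H1_scale(2)[OF uH, of c] by (simp add: power_mult_distrib)
  qed
  define t where "t n = 1 / real (Suc n)" for n
  have t: "0 < t n" "t n \<le> 1" for n by (auto simp: t_def)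
  have t0: "t \<longlonglongrightarrow> 0" unfolding t_def[abs_def] by (rule LIMSEQ_Suc[OF lim_1_over_n])
  \<comment> \<open>Its limit is computed twice: from the explicit expansion, and as 0 because the
    derivative of J at u is 0.\<close>
  define D where "D n = (J f \<rho> (\<lambda>x. u x + t n * u x) - J f \<rho> u) / t n" for n
  \<comment> \<open>The coefficients are ((1 + t)^2 - 1) / (2 t) and ((1 + t)^4 - 1) / (4
    t).\<close>
  have D_eq: "D n = (1 + t n / 2) * ?N\<^sup>2 + (1 + 3/2 * t n + (t n)\<^sup>2 + (t n) ^ 3 / 4) * ?A
      - (\<integral>x. (primitive f (v x + t n * v x) - primitive f (v x)) / t n \<partial>lborel)" for n
  proof -
    have i: "integrable lborel (\<lambda>x. primitive f (v x + t n * v x))"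
      using integrable_primitive[OF sobolev_pair_scale[OF sp, of "1 + t n"]] by (simp add: distrib_right)
    have "J f \<rho> (\<lambda>x. u x + t n * u x) = 1/2 * (1 + t n)\<^sup>2 * ?N\<^sup>2 + 1/4 * (1 + t n) ^ 4 * ?A
        - (\<integral>x. primitive f (v x + t n * v x) \<partial>lborel)"
      using J_ray[of "1 + t n"] by (simp add: distrib_right)
    moreover have "J f \<rho> u = 1/2 * ?N\<^sup>2 + 1/4 * ?A - (\<integral>x. primitive f (v x) \<partial>lborel)"
      using J_ray[of 1] by simp
    moreover have "(\<integral>x. (primitive f (v x + t n * v x) - primitive f (v x)) / t n \<partial>lborel) =
        ((\<integral>x. primitive f (v x + t n * v x) \<partial>lborel) - (\<integral>x. primitive f (v x) \<partial>lborel)) / t n"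
      using i integrable_primitive[OF sp] by simp
    ultimately show ?thesis
      unfolding D_def using t(1)[of n]
      by (simp add: divide_simps) (simp add: power2_eq_square power3_eq_cube power4_eq_xxxx algebra_simps)
  qed
  have "(\<lambda>n. \<integral>x. (primitive f (v x + t n * v x) - primitive f (v x)) / t n \<partial>lborel) \<longlonglongrightarrow> ?I"
  proof (rule integral_dominated_convergence)
    show "integrable lborel (\<lambda>x. 4 * C * ((v x)\<^sup>2 + \<bar>v x\<bar> ^ 3))"
      using integrable_square_cube[OF sp] by (rule integrable_mult_right)
    show "AE x in lborel. (\<lambda>n. (primitive f (v x + t n * v x) - primitive f (v x)) / t n) \<longlonglongrightarrow> f (v x) * v x"
    proof (rule AE_I2)
      fix x
      have 1: "((\<lambda>s. v x + s * v x) has_real_derivative v x) (at 0)"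
        by (auto intro!: derivative_eq_intros)
      have "(primitive f has_real_derivative f (v x + 0 * v x)) (at (v x + 0 * v x))"
        by (rule primitive_has_derivative[OF f_cont])
      from DERIV_chain2[OF this 1]
      have "((\<lambda>s. (primitive f (v x + s * v x) - primitive f (v x)) / s) \<longlongrightarrow> f (v x) * v x) (at 0)"
        by (simp add: has_field_derivative_iff)
      then show "(\<lambda>n. (primitive f (v x + t n * v x) - primitive f (v x)) / t n) \<longlonglongrightarrow> f (v x) * v x"
        by (rule filterlim_compose) (use t0 t(1) in \<open>auto simp: filterlim_at less_imp_neq[symmetric]\<close>)
    qed
    show "AE x in lborel. norm ((primitive f (v x + t n * v x) - primitive f (v x)) / t n)
        \<le> 4 * C * ((v x)\<^sup>2 + \<bar>v x\<bar> ^ 3)" for n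
    proof (rule AE_I2)
      fix x
      \<comment> \<open>Since t \<le> 1, both arguments of the primitive lie in [-2|v|, 2|v|]; the
        factor t in their distance cancels the denominator, so the majorant is independent of
        n.\<close>
      have "\<bar>t n * v x\<bar> \<le> \<bar>v x\<bar>" using t[of n] by (simp add: abs_mult mult_left_le_one_le)
      then have "\<bar>primitive f (v x + t n * v x) - primitive f (v x)\<bar>
          \<le> C * (2 * \<bar>v x\<bar> + (2 * \<bar>v x\<bar>)\<^sup>2) * \<bar>v x + t n * v x - v x\<bar>"
        by (intro primitive_diff_le[OF f_cont C_nonneg growth]) auto
      also have "\<dots> = C * (2 * (v x)\<^sup>2 + 4 * \<bar>v x\<bar> ^ 3) * t n"
        using t(1)[of n] by (simp add: abs_mult power3_eq_cube power2_eq_square algebra_simps)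
      also have "\<dots> \<le> 4 * C * ((v x)\<^sup>2 + \<bar>v x\<bar> ^ 3) * t n"
        using t(1)[of n] C_nonneg by (intro mult_right_mono) (auto simp: algebra_simps intro!: mult_right_mono)
      finally show "norm ((primitive f (v x + t n * v x) - primitive f (v x)) / t n)
          \<le> 4 * C * ((v x)\<^sup>2 + \<bar>v x\<bar> ^ 3)"
        using t(1)[of n] by (simp add: abs_div pos_divide_le_eq)
    qed
  qed measurable
  then have "D \<longlonglongrightarrow> (1 + 0 / 2) * ?N\<^sup>2 + (1 + 3/2 * 0 + 0\<^sup>2 + 0 ^ 3 / 4) * ?A - ?I"
    unfolding D_eq[abs_def] by (intro tendsto_intros t0) auto
  moreover have "D \<longlonglongrightarrow> 0"
  proof (rule LIMSEQ_I)
    fix e :: real assume "0 < e"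
    \<comment> \<open>Adding 1 to the norm covers norm 0 and makes the final inequality
      strict.\<close>
    define \<epsilon> where "\<epsilon> = e / (?N + 1)"
    have N0: "0 \<le> ?N" by (rule H1_norm_nonneg)
    have \<epsilon>: "0 < \<epsilon>" "\<epsilon> * ?N < e"
      using \<open>0 < e\<close> N0 by (auto simp: \<epsilon>_def field_simps)
    obtain \<delta> where \<delta>: "0 < \<delta>"
      "\<And>h. h \<in> H1 \<Longrightarrow> H1_norm h < \<delta> \<Longrightarrow> \<bar>J f \<rho> (\<lambda>x. u x + h x) - J f \<rho> u\<bar> \<le> \<epsilon> * H1_norm h"
      using sol \<epsilon>(1) unfolding solution_def critical_point_def has_H1_derivative_def by auto
    have "(\<lambda>n. t n * ?N) \<longlonglongrightarrow> 0 * ?N" by (intro tendsto_intros t0)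
    then have "\<forall>\<^sub>F n in sequentially. t n * ?N < \<delta>"
      using \<delta>(1) by (intro order_tendstoD(2)[of _ "0 * ?N"]) auto
    then obtain n0 where n0: "\<And>n. n0 \<le> n \<Longrightarrow> t n * ?N < \<delta>"
      by (auto simp: eventually_sequentially)
    have "norm (D n - 0) < e" if "n0 \<le> n" for n
    proof -
      have h: "H1_norm (\<lambda>x. t n * u x) = t n * ?N"
        using H1_scale(2)[OF uH, of "t n"] t(1)[of n] by simp
      have "\<bar>J f \<rho> (\<lambda>x. u x + t n * u x) - J f \<rho> u\<bar> \<le> \<epsilon> * (t n * ?N)"
        using \<delta>(2)[OF H1_scale(1)[OF uH, of "t n"]] n0[OF that] unfolding h by blast
      then have "\<bar>D n\<bar> \<le> \<epsilon> * ?N"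
        unfolding D_def using t(1)[of n] by (simp add: abs_div pos_divide_le_eq mult_ac)
      then show ?thesis using \<epsilon>(2) by simp
    qed
    then show "\<exists>n0. \<forall>n\<ge>n0. norm (D n - 0) < e" by blast
  qed
  ultimately have "(1 + 0 / 2) * ?N\<^sup>2 + (1 + 3/2 * 0 + 0\<^sup>2 + 0 ^ 3 / 4) * ?A - ?I = 0"
    by (rule LIMSEQ_unique)
  then show ?thesis by simp
qed

lemma solution_trivial:
  assumes sol: "solution f \<rho> u" and Lambda: "ereal (INF x. \<rho> x) > ereal_sqrt (Lambda0_bar f)"
  shows "AE x in lebesgue. u x = 0"
proof -
  have uH: "u \<in> H1" using sol by (simp add: solution_def critical_point_def)
  let ?S = "(H1_norm u)\<^sup>2"
  obtain v g where sp: "sobolev_pair v g" and uv: "AE x in lborel. u x = v x"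
    and Sv: "(\<integral>x. (v x)\<^sup>2 \<partial>lborel) \<le> ?S" and Sg: "(\<integral>x. (norm (g x))\<^sup>2 \<partial>lborel) \<le> ?S"
    using H1_obtain_pair[OF uH] by blast
  note v_borel [measurable] = sobolev_pair_components(1)[OF sp]
  interpret one: coulomb_weight "\<lambda>_. 1" 1 by unfold_locales auto
  define A where "A = (\<integral>x. \<rho> x * phi \<rho> v x * (v x)\<^sup>2 \<partial>lborel)"
  define D where "D = (\<integral>x. phi (\<lambda>_. 1) v x * (v x)\<^sup>2 \<partial>lborel)"
  have A0: "0 \<le> A" unfolding A_def by (rule energy_nonneg[OF sp Sv Sg])
  have D0: "0 \<le> D" unfolding D_def using one.energy_nonneg[OF sp Sv Sg] by simp
  have "A = 0"
  proof (rule ccontr)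
    assume "A \<noteq> 0"
    then have "0 < A" using A0 by simp
    \<comment> \<open>With D = 0 the quotient A / D would be the default value 0, and the supremum
      would give no bound for A.\<close>
    have "D \<noteq> 0"
    proof
      assume "D = 0"
      then have "AE x in lborel. v x = 0"
        unfolding D_def using one.energy_eq_0D[OF sp Sv Sg] by simp
      then have "A = (\<integral>x. 0 \<partial>(lborel :: (real^3) measure))"
        unfolding A_def using phi_borel[OF sp Sv Sg] by (intro integral_cong_AE) (auto elim: eventually_mono)
      then show False using \<open>A \<noteq> 0\<close> by simp
    qed
    then have "0 < D" using D0 by simp
    have "(\<integral>x. f (u x) * u x \<partial>lebesgue) = (\<integral>x. f (v x) * v x \<partial>lborel)"
      by (rule integral_lebesgue_lborel(1)) (use uv in \<open>auto elim: eventually_mono\<close>)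
    then have num: "(\<integral>x. f (u x) * u x \<partial>lebesgue) - ?S = A"
      using nehari_identity[OF sol sp uv] by (simp add: A_def)
    have den: "(\<integral>x. phi (\<lambda>_. 1) u x * (u x)\<^sup>2 \<partial>lebesgue) = D"
      using one.lebesgue_energy_eq(2)[OF v_borel sp uv] by (simp add: D_def)
    have "u \<in> A0_bar f" using uH num \<open>0 < A\<close> by (simp add: A0_bar_def)
    then have le: "ereal (A / D) \<le> Lambda0_bar f"
      unfolding Lambda0_bar_def by (rule SUP_upper2) (simp add: num den)
    have r: "0 < A / D" using \<open>0 < A\<close> \<open>0 < D\<close> by simp
    \<comment> \<open>An infinite supremum is returned unchanged by \<open>ereal_sqrt\<close>; minus
      infinity is ruled out by \<open>le\<close>.\<close>
    have "ereal (sqrt (A / D)) \<le> ereal_sqrt (Lambda0_bar f)"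
      using le r by (cases "Lambda0_bar f") (auto simp: ereal_sqrt_def)
    with Lambda have "ereal (sqrt (A / D)) < ereal (INF x. \<rho> x)" by (rule le_less_trans[rotated])
    then have m: "sqrt (A / D) < (INF x. \<rho> x)" by simp
    have m0: "0 \<le> (INF x. \<rho> x)" using weight_pos by (intro cINF_greatest) (auto simp: less_imp_le)
    have "(sqrt (A / D))\<^sup>2 < (INF x. \<rho> x)\<^sup>2" using m r by (intro power_strict_mono) auto
    then have "A < (INF x. \<rho> x)\<^sup>2 * D" using r \<open>0 < D\<close> by (simp add: pos_divide_less_eq)
    also have "\<dots> \<le> A"
      unfolding A_def D_def
    proof (rule energy_ge[OF sp Sv Sg m0])
      \<comment> \<open>The real-valued infimum is a genuine lower bound only for a range bounded
        below, here by 0.\<close>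
      have "bdd_below (range \<rho>)" using weight_pos by (intro bdd_belowI[of _ 0]) (auto simp: less_imp_le)
      then show "(INF x. \<rho> x) \<le> \<rho> x" for x by (rule cINF_lower) simp
    qed
    finally show False by simp
  qed
  then have "AE x in lborel. v x = 0"
    unfolding A_def by (rule energy_eq_0D[OF sp Sv Sg])
  with uv have "AE x in lborel. u x = 0" by eventually_elim simp
  then show ?thesis by (rule AE_completion)
qed

end

lemma weight_bounded_above:
  assumes "continuous_on UNIV \<rho>" "D1 \<rho>"
  obtains K where "\<And>x. \<rho> x \<le> K"
proof -
  obtain l where "(\<rho> \<longlongrightarrow> l) at_infinity" using assms(2) by (auto simp: D1_def)
  then have "\<forall>\<^sub>F x in at_infinity. dist (\<rho> x) l < 1" by (rule tendstoD) simp
  then obtain b where b: "\<And>x. b \<le> norm x \<Longrightarrow> \<bar>\<rho> x - l\<bar> < 1"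
    by (auto simp: eventually_at_infinity dist_real_def)
  have "bounded (\<rho> ` cball 0 b)"
    using assms(1) by (intro compact_imp_bounded compact_continuous_image) (auto intro: continuous_on_subset)
  then obtain B where B: "\<And>x. x \<in> cball 0 b \<Longrightarrow> \<bar>\<rho> x\<bar> \<le> B"
    unfolding bounded_iff by (metis imageI real_norm_def)
  show thesis
  proof (rule that)
    show "\<rho> x \<le> max B (l + 1)" for x
      using b[of x] B[of x] by (cases "b \<le> norm x") auto
  qed
qed

theorem theorem1p3:
  fixes f :: "real \<Rightarrow> real" and \<rho> :: "real^3 \<Rightarrow> real"
  assumes "F1 f" and "F2 f"
    and "continuous_on UNIV \<rho>" and "D1 \<rho>"
    and "ereal (INF x. \<rho> x) > ereal_sqrt (Lambda0_bar f)"
  shows "solution f \<rho> (\<lambda>_. 0) \<and>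
    (\<forall>u. solution f \<rho> u \<longrightarrow> (AE x in lebesgue. u x = 0))"
proof -
  obtain C where C: "0 \<le> C" "\<And>s. \<bar>f s\<bar> \<le> C * (\<bar>s\<bar> + s\<^sup>2)"
    using nonlinearity_growth[OF assms(1,2)] by blast
  obtain K where K: "\<And>x. \<rho> x \<le> K" using weight_bounded_above[OF assms(3,4)] by blast
  interpret schroedinger_poisson \<rho> K f C
    using C K assms(1,3,4)
    by unfold_locales (auto simp: D1_def F1_def intro: borel_measurable_continuous_onI)
  show ?thesis using solution_zero solution_trivial assms(5) by blast
qed

end
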